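(* Let $N\ge 1$ and let $f_1,\dots,f_N$ be fermionic annihilation operators on the Fock space $\mathcal F\cong\mathbb C^{2^N}$, satisfying $\{f_i,f_j^\dagger\}=\delta_{ij}$, $\{f_i,f_j\}=0$. Let $\{1,\dots,N\}=A\sqcup B$ be a partition into disjoint sets with $|A|\ge|B|$. Let $h$ be a Hermitian $N\times N$ matrix with $h_{ij}=0$ whenever $i,j\in A$ or $i,j\in B$, and let $$H_F=\sum_{i\in A,\,j\in B} f_i^\dagger h_{ij} f_j+\mathrm{H.c.}$$ Then there exists an orthonormal basis $\{|E_s\rangle\}_{s\in\{0,1\}^N}$ of $\mathcal F$ consisting of pure Gaussian states that are simultaneous eigenvectors of $H_F$ and of the number operator $\hat N=\sum_i f_i^\dagger f_i$, and integers $n(s)\in\{0,1,\dots,|B|\}$, such that for every $s$ and every Rényi index $\alpha$ one has $S_\alpha(B|E_s)=n(s)$. Moreover, at least one of these basis vectors is a ground state of $H_F$ (an eigenvector for the smallest eigenvalue) with $n(s)=|B|$, i.e. it is maximally entangled between $A$ and $B$.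
   Context: Gaussian states: states satisfying Wick's theorem, i.e. determined by their two-point correlation functions (e.g. Slater determinants $a_{k_1}^\dagger\cdots a_{k_m}^\dagger|0\rangle$ built from orthonormal single-particle modes, $|0\rangle$ the vacuum annihilated by all $f_j$). For a pure state $|\psi\rangle$, the reduced state $\rho_B$ on the modes in $B$ is the density matrix on the Fock space of the modes $\{f_j\}_{j\in B}$ reproducing the expectation values of all operators in the algebra generated by $\{f_j,f_j^\dagger\}_{j\in B}$ (equivalently, order the modes with $B$ first, identify Fock space with $\mathbb C^{2^{|B|}}\otimes\mathbb C^{2^{|A|}}$ and take the partial trace over $A$). $S_\alpha(B|\psi)=\frac{1}{1-\alpha}\log_2\operatorname{Tr}\rho_B^\alpha$ (with $\alpha=1$ the von Neumann entropy $-\operatorname{Tr}\rho_B\log_2\rho_B$), i.e. entropies are measured in units of $\log 2$; the maximal possible value is $|B|$. *)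

theory Defs
  imports "Jordan_Normal_Form.Schur_Decomposition"
begin

text \<open>Modes are labelled 0,...,N-1 (the paper's 1,...,N shifted by one).
  The Fock space is C^(2^N); basis vector number x (x < 2^N) is the occupation
  state in which mode j is occupied iff bit j of x is set, namely
  f_{j1}^dagger ... f_{jm}^dagger |0> with j1 < ... < jm the occupied modes.\<close>

definition jw_sign :: "nat \<Rightarrow> nat \<Rightarrow> complex" where
  "jw_sign x j = (-1) ^ card {k. k < j \<and> bit x k}"

definition fann :: "nat \<Rightarrow> nat \<Rightarrow> complex mat" where
  "fann N j = mat (2^N) (2^N)
     (\<lambda>(y, x). if bit x j \<and> y = x - 2^j then jw_sign x j else 0)"

definition fcre :: "nat \<Rightarrow> nat \<Rightarrow> complex mat" where
  "fcre N j = mat_adjoint (fann N j)"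

definition HF :: "nat \<Rightarrow> nat set \<Rightarrow> nat set \<Rightarrow> complex mat \<Rightarrow> complex mat" where
  "HF N A B h = mat (2^N) (2^N) (\<lambda>(y, x).
     \<Sum>i\<in>A. \<Sum>j\<in>B. h $$ (i, j) * (fcre N i * fann N j) $$ (y, x)
                 + cnj (h $$ (i, j)) * (fcre N j * fann N i) $$ (y, x))"

definition Nop :: "nat \<Rightarrow> complex mat" where
  "Nop N = mat (2^N) (2^N) (\<lambda>(y, x). \<Sum>j<N. (fcre N j * fann N j) $$ (y, x))"

definition op_of :: "nat \<Rightarrow> nat \<times> bool \<Rightarrow> complex mat" where
  "op_of N w = (if snd w then fcre N (fst w) else fann N (fst w))"

definition word_op :: "nat \<Rightarrow> (nat \<times> bool) list \<Rightarrow> complex mat" where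
  "word_op N ops = foldr (\<lambda>w M. op_of N w * M) ops (1\<^sub>m (2^N))"

definition expect :: "nat \<Rightarrow> complex vec \<Rightarrow> (nat \<times> bool) list \<Rightarrow> complex" where
  "expect N \<psi> ops = (word_op N ops *\<^sub>v \<psi>) \<bullet>c \<psi>"

text \<open>The right-hand side of Wick's theorem, computed from a two-point function
  E [o,o'] by recursive expansion along the first operator (sum over all
  pairings with ordered contractions and the fermionic sign); it vanishes
  for words of odd length.\<close>
function wick :: "((nat \<times> bool) list \<Rightarrow> complex) \<Rightarrow> (nat \<times> bool) list \<Rightarrow> complex" where
  "wick E [] = 1"
| "wick E [w] = 0"
| "wick E (w # p # rest) =
     (\<Sum>k < length (p # rest).
        (-1) ^ k * E [w, (p # rest) ! k]
          * wick E (take k (p # rest) @ drop (Suc k) (p # rest)))"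
  by pat_completeness auto
termination
  by (relation "measure (\<lambda>(E, ops). length ops)") auto

definition pure_gaussian :: "nat \<Rightarrow> complex vec \<Rightarrow> bool" where
  "pure_gaussian N \<psi> \<longleftrightarrow> \<psi> \<in> carrier_vec (2^N) \<and> \<psi> \<bullet>c \<psi> = 1 \<and>
     (\<forall>ops. set (map fst ops) \<subseteq> {..<N} \<longrightarrow> expect N \<psi> ops = wick (expect N \<psi>) ops)"

text \<open>Basis index of the state in which the k-th element of B (in increasing
  order) is occupied iff bit k of y is set, and the k-th element of A is
  occupied iff bit k of z is set.\<close>
definition join_idx :: "nat set \<Rightarrow> nat set \<Rightarrow> nat \<Rightarrow> nat \<Rightarrow> nat" where
  "join_idx A B y z =
     (\<Sum>k<card B. if bit y k then 2 ^ (sorted_list_of_set B ! k) else 0)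
   + (\<Sum>k<card A. if bit z k then 2 ^ (sorted_list_of_set A ! k) else 0)"

text \<open>Sign relating the original ordering of the modes to the ordering in
  which all modes of B come first: |x> = reorder_sign * |y> (x) |z>.\<close>
definition reorder_sign :: "nat set \<Rightarrow> nat set \<Rightarrow> nat \<Rightarrow> complex" where
  "reorder_sign A B x =
     (-1) ^ card {(a, b). a \<in> A \<and> b \<in> B \<and> a < b \<and> bit x a \<and> bit x b}"

definition reduced_state :: "nat set \<Rightarrow> nat set \<Rightarrow> complex vec \<Rightarrow> complex mat" where
  "reduced_state A B \<psi> = mat (2 ^ card B) (2 ^ card B) (\<lambda>(y, y').
     \<Sum>z < 2 ^ card A.
        (reorder_sign A B (join_idx A B y z) * \<psi> $ join_idx A B y z)
      * cnj (reorder_sign A B (join_idx A B y' z) * \<psi> $ join_idx A B y' z))"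

text \<open>Eigenvalues are counted with algebraic multiplicity; for a density
  matrix they are real and nonnegative. Tr rho^alpha = sum of lambda^alpha over
  the positive eigenvalues lambda.\<close>
definition pos_eigs :: "complex mat \<Rightarrow> complex set" where
  "pos_eigs \<rho> = {l. eigenvalue \<rho> l \<and> Re l > 0}"

definition tr_power :: "complex mat \<Rightarrow> real \<Rightarrow> real" where
  "tr_power \<rho> \<alpha> = (\<Sum>l\<in>pos_eigs \<rho>. real (order l (char_poly \<rho>)) * Re l powr \<alpha>)"

definition renyi_entropy :: "real \<Rightarrow> complex mat \<Rightarrow> real" where
  "renyi_entropy \<alpha> \<rho> =
     (if \<alpha> = 1
      then - (\<Sum>l\<in>pos_eigs \<rho>. real (order l (char_poly \<rho>)) * Re l * log 2 (Re l))
      else (1 / (1 - \<alpha>)) * log 2 (tr_power \<rho> \<alpha>))"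

end

theory Submission
  imports Defs
begin

text \<open>Write the block of \<open>h\<close> between \<open>A\<close> and \<open>B\<close> in singular value form with singular
  vectors \<open>u\<^sub>k\<close> on \<open>A\<close> and \<open>v\<^sub>k\<close> on \<open>B\<close>. The modes \<open>(v\<^sub>k \<plusminus> u\<^sub>k) / sqrt 2\<close> for \<open>k < card B\<close> have
  energies \<open>\<plusminus> s\<^sub>k\<close>, the remaining \<open>u\<^sub>k\<close> are zero modes, and the Slater determinants of these modes
  are a Gaussian eigenbasis. A pair \<open>k\<close> of which exactly one mode is occupied contributes one
  unit of entanglement and every other pair none, so the reduced state is \<open>2\<^sup>-\<^sup>n\<close> times a projection,
  where \<open>n\<close> counts the singly occupied pairs. Occupying precisely the modes of energy \<open>- s\<^sub>k\<close>
  gives a ground state with \<open>n = card B\<close>.\<close>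

section \<open>Fermionic operators and Slater determinants\<close>

text \<open>An arbitrary eigenbasis need not have integer entropies when singular values coincide or
  vanish. The singular vectors therefore fix the pairs, and a pair is hybridised even if
  \<open>s\<^sub>k = 0\<close>; this secures a ground state in which every pair is singly occupied.
  Entropies are not computed from correlation functions: the amplitudes, with B-occupations as rows
  and A-occupations as columns, form a matrix K whose reduced state is
  \<open>K K\<^sup>\<dagger>\<close>. The cubic identity \<open>K K\<^sup>\<dagger> K = c K\<close>
  can be carried through one creation operator or pair at a time, without diagonalising anything; c
  is halved exactly at singly occupied pairs. With unit trace it forces a flat spectrum, which
  settles all Renyi indices at once. The obstacle is the fermionic sign: operators on A must pass
  the B-modes, so each of them carries the parity of B, and the reordering sign has to turn the
  original Jordan-Wigner strings into this form. Minimality of the ground energy rests on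
  completeness: every eigenvalue is a sum of energies of occupied modes, and no such sum lies below
  the sum of all the negative energies.\<close>

text \<open>Fock vectors are handled as functions on all of \<open>nat\<close>, so that the operators carry no dimension;
  only the inner product and the coordinate vectors refer to a cutoff. The flag is \<open>True\<close> for
  creation and \<open>False\<close> for annihilation.\<close>

definition fop :: "bool \<Rightarrow> nat \<Rightarrow> (nat \<Rightarrow> complex) \<Rightarrow> nat \<Rightarrow> complex" where
  "fop t j \<phi> x = (if bit x j = t then jw_sign x j * \<phi> (flip_bit j x) else 0)"

text \<open>General element of the span of annihilators (weights \<open>p\<close>) and creators
  (weights \<open>q\<close>). Both kinds are mixed because the splitting behind Wick's theorem
  leaves neither span invariant.\<close>

definition lop :: "nat \<Rightarrow> (nat \<Rightarrow> complex) \<Rightarrow> (nat \<Rightarrow> complex) \<Rightarrow> (nat \<Rightarrow> complex) \<Rightarrow> nat \<Rightarrow> complex" where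
  "lop n p q \<phi> x = (\<Sum>i<n. p i * fop False i \<phi> x + q i * fop True i \<phi> x)"

definition ip :: "nat \<Rightarrow> (nat \<Rightarrow> complex) \<Rightarrow> (nat \<Rightarrow> complex) \<Rightarrow> complex" where
  "ip n u v = (\<Sum>i<n. u i * cnj (v i))"

text \<open>The conjugated weights make this the adjoint of \<open>crea n w\<close>; it is
  antilinear in \<open>w\<close>.\<close>

definition anni :: "nat \<Rightarrow> (nat \<Rightarrow> complex) \<Rightarrow> (nat \<Rightarrow> complex) \<Rightarrow> nat \<Rightarrow> complex" where
  "anni n w = lop n (\<lambda>i. cnj (w i)) (\<lambda>_. 0)"

definition crea :: "nat \<Rightarrow> (nat \<Rightarrow> complex) \<Rightarrow> (nat \<Rightarrow> complex) \<Rightarrow> nat \<Rightarrow> complex" where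
  "crea n w = lop n (\<lambda>_. 0) w"

text \<open>In product form, toggling one bit changes one factor, so all later sign computations
  become manipulations of products.\<close>

lemma jw_sign_prod: "jw_sign x j = (\<Prod>k<j. if bit x k then -1 else 1)"
proof -
  have "(\<Prod>k<j. if bit x k then -1 else 1 :: complex) = (-1) ^ card ({..<j} \<inter> {k. bit x k})"
    by (subst prod.If_cases) (auto simp: prod_constant)
  also have "{..<j} \<inter> {k. bit x k} = {k. k < j \<and> bit x k}" by auto
  finally show ?thesis by (simp add: jw_sign_def)
qed

lemma jw_sign_square [simp]: "jw_sign x j * jw_sign x j = 1"
  unfolding jw_sign_def by (simp add: power_mult_distrib[symmetric])

lemma cnj_jw_sign [simp]: "cnj (jw_sign x j) = jw_sign x j"
  by (simp add: jw_sign_def)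

lemma flip_bit_nat_simps [simp]:
  fixes x :: nat
  shows "bit (flip_bit i x) j \<longleftrightarrow> bit x j \<noteq> (i = j)"
    and "flip_bit i (flip_bit i x) = x"
  by (auto simp: bit_flip_bit_iff intro!: bit_eqI)

lemma flip_bit_commute: "flip_bit i (flip_bit j x) = flip_bit j (flip_bit i (x :: nat))"
  by (rule bit_eqI) auto

lemma flip_bit_less:
  fixes x :: nat
  assumes "x < 2 ^ n" and "i < n"
  shows "flip_bit i x < 2 ^ n"
proof -
  have "take_bit n (flip_bit i x) = flip_bit i x"
    using assms by (simp add: take_bit_flip_bit_eq take_bit_nat_eq_self)
  then show ?thesis by (metis take_bit_nat_less_exp)
qed

lemma jw_sign_flip_bit:
  "jw_sign (flip_bit i x) j = (if i < j then - jw_sign x j else jw_sign x j)"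
proof (cases "i < j")
  case True
  have "(\<Prod>k\<in>{..<j} - {i}. if bit (flip_bit i x) k then -1 else 1 :: complex)
      = (\<Prod>k\<in>{..<j} - {i}. if bit x k then -1 else 1)"
    by (intro prod.cong) auto
  then show ?thesis
    using True unfolding jw_sign_prod by (subst (1 2) prod.remove[of _ i]) auto
next
  case False
  then show ?thesis unfolding jw_sign_prod by (auto intro!: prod.cong)
qed

text \<open>For distinct modes only the operator of larger index has the other mode in its sign
  string, so exactly one of the two orders picks up an extra minus. For equal modes the occupation
  tests kill both terms, or all but one term, whose sign squares to 1.\<close>

lemma fop_anticommute:
  "fop t i (fop u j \<phi>) x + fop u j (fop t i \<phi>) x = (if i = j \<and> t \<noteq> u then \<phi> x else 0)"
proof (cases "i = j")
  case True
  have "jw_sign x j * (jw_sign x j * \<phi> x) = \<phi> x"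
    by (simp flip: mult.assoc)
  then show ?thesis using True by (auto simp: fop_def jw_sign_flip_bit)
next
  case False
  then have "i < j \<or> j < i" by auto
  then show ?thesis using False
    by (auto simp: fop_def jw_sign_flip_bit flip_bit_commute[of i j])
qed

lemma fop_sum: "fop t j (\<lambda>x. \<Sum>i\<in>I. f i x) = (\<lambda>x. \<Sum>i\<in>I. fop t j (f i) x)"
  by (auto simp: fop_def fun_eq_iff sum_distrib_left)

lemma fop_linear:
  "fop t j (\<lambda>x. c * \<phi> x + d * \<chi> x) = (\<lambda>x. c * fop t j \<phi> x + d * fop t j \<chi> x)"
  by (auto simp: fop_def fun_eq_iff algebra_simps)

lemma fop_scale: "fop t j (\<lambda>x. c * \<phi> x) = (\<lambda>x. c * fop t j \<phi> x)"
  using fop_linear[of t j c \<phi> 0] by simp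

lemma lop_linear:
  "lop n p q (\<lambda>x. c * \<phi> x + d * \<chi> x) = (\<lambda>x. c * lop n p q \<phi> x + d * lop n p q \<chi> x)"
  by (simp add: lop_def fun_eq_iff fop_linear sum_distrib_left sum.distrib algebra_simps)

lemma lop_scale: "lop n p q (\<lambda>x. c * \<phi> x) = (\<lambda>x. c * lop n p q \<phi> x)"
  using lop_linear[of n p q c \<phi> 0] by simp

lemma lop_zero [simp]: "lop n p q (\<lambda>_. 0) = (\<lambda>_. 0)"
  using lop_scale[of n p q 0] by simp

lemma lop_sum: "lop n p q (\<lambda>x. \<Sum>i\<in>I. f i x) = (\<lambda>x. \<Sum>i\<in>I. lop n p q (f i) x)"
  by (simp add: lop_def fun_eq_iff fop_sum sum_distrib_left sum.distrib sum.swap[of _ I])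

lemma fop_eq_lop:
  assumes "j < n"
  shows "fop t j = lop n (\<lambda>i. of_bool (i = j \<and> \<not> t)) (\<lambda>i. of_bool (i = j \<and> t))"
proof (intro ext)
  fix \<phi> x
  have "lop n (\<lambda>i. of_bool (i = j \<and> \<not> t)) (\<lambda>i. of_bool (i = j \<and> t)) \<phi> x
      = (\<Sum>i<n. if i = j then fop t i \<phi> x else 0)"
    unfolding lop_def by (intro sum.cong) auto
  then show "fop t j \<phi> x = lop n (\<lambda>i. of_bool (i = j \<and> \<not> t)) (\<lambda>i. of_bool (i = j \<and> t)) \<phi> x"
    using assms by simp
qed

text \<open>The symmetric bilinear form of the Clifford algebra: the scalar to which the
  anticommutator of two linear operators reduces.\<close>

definition acomm :: "nat \<Rightarrow> (nat \<Rightarrow> complex) \<Rightarrow> (nat \<Rightarrow> complex) \<Rightarrow> (nat \<Rightarrow> complex) \<Rightarrow> (nat \<Rightarrow> complex) \<Rightarrow> complex" where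
  "acomm n p q p' q' = (\<Sum>i<n. p i * q' i + q i * p' i)"

lemma lop_eq_sum_pairs:
  "lop n p q \<phi> x = (\<Sum>a\<in>{..<n} \<times> UNIV. (if snd a then q (fst a) else p (fst a)) * fop (snd a) (fst a) \<phi> x)"
  by (simp add: lop_def sum.cartesian_product' UNIV_bool add.commute)

lemma lop_anticommute:
  "lop n p q (lop n p' q' \<phi>) x + lop n p' q' (lop n p q \<phi>) x = acomm n p q p' q' * \<phi> x"
proof -
  define S where "S = {..<n} \<times> (UNIV :: bool set)"
  define F where "F a b = fop (snd a) (fst a) (fop (snd b) (fst b) \<phi>) x" for a b
  define P where "P a = (if snd a then q (fst a) else p (fst a))" for a
  define P' where "P' a = (if snd a then q' (fst a) else p' (fst a))" for a
  have L: "lop n p q = (\<lambda>\<phi> x. \<Sum>a\<in>S. P a * fop (snd a) (fst a) \<phi> x)"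
    and L': "lop n p' q' = (\<lambda>\<phi> x. \<Sum>a\<in>S. P' a * fop (snd a) (fst a) \<phi> x)"
    by (simp_all add: fun_eq_iff lop_eq_sum_pairs P_def P'_def S_def)
  have 1: "lop n p q (lop n p' q' \<phi>) x = (\<Sum>a\<in>S. \<Sum>b\<in>S. P a * (P' b * F a b))"
    unfolding L L' fop_sum fop_scale F_def sum_distrib_left ..
  have 2: "lop n p' q' (lop n p q \<phi>) x = (\<Sum>b\<in>S. \<Sum>a\<in>S. P' b * (P a * F b a))"
    unfolding L L' fop_sum fop_scale F_def sum_distrib_left ..
  \<comment> \<open>Only the opposite operator on the same mode as \<open>a\<close> contributes, so
    the double sum collapses to a single one.\<close>
  have 3: "F a b + F b a = (if b = (fst a, \<not> snd a) then \<phi> x else 0)" for a b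
    unfolding F_def fop_anticommute by (cases a; cases b) auto
  have "lop n p q (lop n p' q' \<phi>) x + lop n p' q' (lop n p q \<phi>) x
      = (\<Sum>a\<in>S. \<Sum>b\<in>S. P a * P' b * (F a b + F b a))"
    unfolding 1 2 by (subst (2) sum.swap) (simp add: sum.distrib algebra_simps)
  also have "\<dots> = (\<Sum>a\<in>S. \<Sum>b\<in>S. if b = (fst a, \<not> snd a) then P a * P' b * \<phi> x else 0)"
    unfolding 3 by (intro sum.cong) auto
  also have "\<dots> = (\<Sum>a\<in>S. P a * P' (fst a, \<not> snd a) * \<phi> x)"
    by (intro sum.cong refl, subst sum.delta) (auto simp: S_def)
  also have "\<dots> = acomm n p q p' q' * \<phi> x"
    by (simp add: acomm_def UNIV_bool S_def sum.cartesian_product' P_def P'_def sum.distrib sum_distrib_left sum_distrib_right algebra_simps)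
  finally show ?thesis .
qed

text \<open>Reindexing by \<open>flip_bit j\<close>, an involution of the indices below
  \<open>2 ^ n\<close> because \<open>j < n\<close>, moves the operator to the other side; the sign
  string of \<open>j\<close> does not see bit \<open>j\<close>.\<close>

lemma fop_adjoint:
  assumes "j < n"
  shows "ip (2 ^ n) (fop t j \<phi>) \<chi> = ip (2 ^ n) \<phi> (fop (\<not> t) j \<chi>)"
proof -
  have "ip (2 ^ n) (fop t j \<phi>) \<chi>
      = (\<Sum>x<2 ^ n. (\<lambda>x. fop t j \<phi> x * cnj (\<chi> x)) (flip_bit j x))"
    unfolding ip_def
    by (rule sum.reindex_bij_witness[of _ "flip_bit j" "flip_bit j"]) (auto simp: flip_bit_less assms)
  also have "\<dots> = ip (2 ^ n) \<phi> (fop (\<not> t) j \<chi>)"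
    unfolding ip_def by (intro sum.cong) (auto simp: fop_def jw_sign_flip_bit)
  finally show ?thesis .
qed

lemma ip_sum_left: "ip n (\<lambda>x. \<Sum>i\<in>I. f i x) v = (\<Sum>i\<in>I. ip n (f i) v)"
  by (simp add: ip_def sum_distrib_right sum.swap[of _ I])

lemma ip_linear_left: "ip n (\<lambda>x. c * u x + d * u' x) v = c * ip n u v + d * ip n u' v"
  by (simp add: ip_def sum_distrib_left sum.distrib algebra_simps)

lemma ip_scale_left: "ip n (\<lambda>x. c * u x) v = c * ip n u v"
  using ip_linear_left[of n c u 0] by simp

lemma cnj_ip: "cnj (ip n u v) = ip n v u"
  by (simp add: ip_def mult.commute)

lemma ip_sum_right: "ip n v (\<lambda>x. \<Sum>i\<in>I. f i x) = (\<Sum>i\<in>I. ip n v (f i))"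
  by (simp add: ip_def sum_distrib_left sum.swap[of _ I])

lemma ip_linear_right: "ip n v (\<lambda>x. c * u x + d * u' x) = cnj c * ip n v u + cnj d * ip n v u'"
  by (simp add: ip_def sum_distrib_left sum.distrib algebra_simps)

lemma ip_scale_right: "ip n v (\<lambda>x. c * u x) = cnj c * ip n v u"
  using ip_linear_right[of n v c u 0] by simp

lemma ip_zero [simp]: "ip n (\<lambda>_. 0) v = 0" "ip n v (\<lambda>_. 0) = 0"
  by (simp_all add: ip_def)

lemma lop_adjoint:
  "ip (2 ^ n) (lop n p q \<phi>) \<chi> = ip (2 ^ n) \<phi> (lop n (\<lambda>i. cnj (q i)) (\<lambda>i. cnj (p i)) \<chi>)"
proof -
  have "ip (2 ^ n) (lop n p q \<phi>) \<chi>
      = (\<Sum>i<n. p i * ip (2 ^ n) (fop False i \<phi>) \<chi> + q i * ip (2 ^ n) (fop True i \<phi>) \<chi>)"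
    unfolding lop_def[abs_def] ip_sum_left ip_linear_left ..
  also have "\<dots> = (\<Sum>i<n. q i * ip (2 ^ n) \<phi> (fop False i \<chi>) + p i * ip (2 ^ n) \<phi> (fop True i \<chi>))"
    by (intro sum.cong) (auto simp: fop_adjoint)
  also have "\<dots> = ip (2 ^ n) \<phi> (lop n (\<lambda>i. cnj (q i)) (\<lambda>i. cnj (p i)) \<chi>)"
    unfolding lop_def[abs_def] ip_sum_right ip_linear_right by simp
  finally show ?thesis .
qed

lemma crea_adjoint: "ip (2 ^ n) (crea n w \<phi>) \<chi> = ip (2 ^ n) \<phi> (anni n w \<chi>)"
  by (simp add: crea_def anni_def lop_adjoint)

lemma crea_crea: "crea n w (crea n w' \<phi>) x = - crea n w' (crea n w \<phi>) x"
  using lop_anticommute[of n "\<lambda>_. 0" w "\<lambda>_. 0" w' \<phi> x]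
  by (simp add: crea_def acomm_def eq_neg_iff_add_eq_0)

lemma crea_crea_same: "crea n w (crea n w \<phi>) = (\<lambda>_. 0)"
  using crea_crea[of n w w \<phi>] by (simp add: fun_eq_iff)

lemma anni_crea: "anni n w (crea n w' \<phi>) x = ip n w' w * \<phi> x - crea n w' (anni n w \<phi>) x"
  using lop_anticommute[of n "\<lambda>i. cnj (w i)" "\<lambda>_. 0" "\<lambda>_. 0" w' \<phi> x]
  by (simp add: crea_def anni_def acomm_def ip_def eq_diff_eq mult.commute)

lemma crea_zero [simp]: "crea n w (\<lambda>_. 0) = (\<lambda>_. 0)" and anni_zero [simp]: "anni n w (\<lambda>_. 0) = (\<lambda>_. 0)"
  by (simp_all add: crea_def anni_def)

section \<open>Slater determinants\<close>

definition vac :: "nat \<Rightarrow> complex" where "vac x = of_bool (x = 0)"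

lemma anni_fop_vac: "fop False i vac = (\<lambda>_. 0)"
proof -
  have "flip_bit i x \<noteq> 0" if "\<not> bit x i" for x :: nat
    using that flip_bit_nat_simps(1)[of i x i] by (metis bit_0_eq bot_apply bot_bool_def)
  then show ?thesis by (auto simp: fop_def vac_def fun_eq_iff)
qed

lemma lop_vac: "lop n p (\<lambda>_. 0) vac = (\<lambda>_. 0)"
  by (simp add: lop_def fun_eq_iff anni_fop_vac)

lemma anni_vac: "anni n w vac = (\<lambda>_. 0)"
  by (simp add: anni_def lop_vac)

definition slater :: "nat \<Rightarrow> (nat \<Rightarrow> complex) list \<Rightarrow> nat \<Rightarrow> complex" where
  "slater n ws = foldr (crea n) ws vac"

lemma slater_simps [simp]: "slater n [] = vac" "slater n (w # ws) = crea n w (slater n ws)"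
  by (simp_all add: slater_def)

text \<open>The annihilator is anticommuted to the vacuum; every contraction on the way is an inner
  product that vanishes.\<close>

lemma anni_slater:
  assumes "\<forall>w'\<in>set ws. ip n w' w = 0"
  shows "anni n w (slater n ws) = (\<lambda>_. 0)"
  using assms
proof (induction ws)
  case (Cons w' ws)
  then have *: "anni n w (slater n ws) = (\<lambda>_. 0)" and "ip n w' w = 0" by auto
  then show ?case by (intro ext) (simp add: anni_crea *)
qed (simp add: anni_vac)

lemma crea_slater:
  assumes "w \<in> set ws"
  shows "crea n w (slater n ws) = (\<lambda>_. 0)"
  using assms
proof (induction ws)
  case (Cons w' ws)
  show ?case
  proof (cases "w = w'")
    case True
    then show ?thesis by (simp add: crea_crea_same)
  next
    case False
    then have *: "crea n w (slater n ws) = (\<lambda>_. 0)" using Cons by simp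
    show ?thesis by (intro ext) (simp add: crea_crea[of n w w'] *)
  qed
qed simp

definition onlist :: "nat \<Rightarrow> (nat \<Rightarrow> complex) list \<Rightarrow> bool" where
  "onlist n ws \<longleftrightarrow> (\<forall>i<length ws. \<forall>j<length ws. ip n (ws ! i) (ws ! j) = of_bool (i = j))"

lemma onlist_Cons:
  "onlist n (w # ws) \<longleftrightarrow> ip n w w = 1 \<and> (\<forall>w'\<in>set ws. ip n w' w = 0) \<and> onlist n ws"
proof
  assume *: "onlist n (w # ws)"
  have "ip n w' w = 0" if w': "w' \<in> set ws" for w'
  proof -
    obtain i where "i < length ws" "w' = ws ! i" using w' by (auto simp: in_set_conv_nth)
    then show ?thesis using *[unfolded onlist_def, rule_format, of "Suc i" 0] by auto
  qed
  moreover have "onlist n ws"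
    unfolding onlist_def
  proof (intro allI impI)
    fix i j assume "i < length ws" "j < length ws"
    then show "ip n (ws ! i) (ws ! j) = of_bool (i = j)"
      using *[unfolded onlist_def, rule_format, of "Suc i" "Suc j"] by auto
  qed
  moreover have "ip n w w = 1" using *[unfolded onlist_def, rule_format, of 0 0] by auto
  ultimately show "ip n w w = 1 \<and> (\<forall>w'\<in>set ws. ip n w' w = 0) \<and> onlist n ws" by blast
next
  assume *: "ip n w w = 1 \<and> (\<forall>w'\<in>set ws. ip n w' w = 0) \<and> onlist n ws"
  then have "\<forall>w'\<in>set ws. ip n w w' = 0" by (metis cnj_ip complex_cnj_zero)
  with * show "onlist n (w # ws)"
    unfolding onlist_def by (auto simp: nth_Cons split: nat.split)
qed

lemma ip_vac: "ip (2 ^ n) vac vac = 1"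
proof -
  have "ip (2 ^ n) vac vac = (\<Sum>x<2 ^ n. if x = (0 :: nat) then 1 else 0)"
    unfolding ip_def by (intro sum.cong) (auto simp: vac_def)
  then show ?thesis by simp
qed

lemma slater_norm: "onlist n ws \<Longrightarrow> ip (2 ^ n) (slater n ws) (slater n ws) = 1"
proof (induction ws)
  case (Cons w ws)
  then have w: "ip n w w = 1" "anni n w (slater n ws) = (\<lambda>_. 0)" and ws: "onlist n ws"
    by (auto simp: onlist_Cons intro: anni_slater)
  have "anni n w (crea n w (slater n ws)) = slater n ws"
    by (simp add: fun_eq_iff anni_crea w)
  then show ?case using Cons.IH[OF ws] by (simp add: crea_adjoint)
qed (simp add: ip_vac)

text \<open>The occupation number of \<open>w\<close> separates the two states:
  \<open>crea n w\<close> after \<open>anni n w\<close> fixes the first one, and its adjoint kills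
  the second.\<close>

lemma ip_slater_eq_0:
  assumes "ip n w w = 1" and "w \<in> set ws" and "\<forall>w'\<in>set ws'. ip n w' w = 0"
  shows "ip (2 ^ n) (slater n ws) (slater n ws') = 0"
proof -
  have "slater n ws = crea n w (anni n w (slater n ws))"
    using anni_crea[of n w w "slater n ws"] crea_slater[OF assms(2), of n] assms(1)
    by (simp add: fun_eq_iff)
  then have "ip (2 ^ n) (slater n ws) (slater n ws')
      = ip (2 ^ n) (anni n w (slater n ws)) (anni n w (slater n ws'))"
    by (metis crea_adjoint)
  then show ?thesis using anni_slater[OF assms(3)] by simp
qed

section \<open>Wick's theorem\<close>

text \<open>Every linear operator splits into a part that annihilates the state and a part whose adjoint does;
  Wick's theorem follows by anticommuting the first part to the right.\<close>

definition quasifree :: "nat \<Rightarrow> (nat \<Rightarrow> complex) \<Rightarrow> bool" where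
  "quasifree n \<psi> \<longleftrightarrow> (\<forall>p q. \<exists>p' q'. lop n p' q' \<psi> = (\<lambda>_. 0) \<and>
     lop n (\<lambda>i. cnj (q i - q' i)) (\<lambda>i. cnj (p i - p' i)) \<psi> = (\<lambda>_. 0))"

lemma quasifree_vac: "quasifree n vac"
  unfolding quasifree_def
proof (intro allI)
  fix p q
  show "\<exists>p' q'. lop n p' q' vac = (\<lambda>_. 0) \<and>
     lop n (\<lambda>i. cnj (q i - q' i)) (\<lambda>i. cnj (p i - p' i)) vac = (\<lambda>_. 0)"
    by (rule exI[of _ p], rule exI[of _ "\<lambda>_. 0"]) (simp add: lop_vac)
qed

text \<open>Filling \<open>w\<close> is a particle-hole exchange in that mode. The old splitting
  fails on the new state only by multiples of the old state, which \<open>anni n w\<close> recovers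
  from the new one, so a correction along \<open>w\<close> repairs it.\<close>

lemma quasifree_crea:
  assumes \<psi>: "quasifree n \<psi>" and w: "ip n w w = 1" and ann: "anni n w \<psi> = (\<lambda>_. 0)"
  shows "quasifree n (crea n w \<psi>)"
  unfolding quasifree_def
proof (intro allI)
  fix p q
  obtain p' q' where minus: "lop n p' q' \<psi> = (\<lambda>_. 0)"
    and plus: "lop n (\<lambda>i. cnj (q i - q' i)) (\<lambda>i. cnj (p i - p' i)) \<psi> = (\<lambda>_. 0)"
    using \<psi> unfolding quasifree_def by meson
  define c where "c = acomm n p' q' (\<lambda>_. 0) w"
  define d where "d = acomm n (\<lambda>i. cnj (q i - q' i)) (\<lambda>i. cnj (p i - p' i)) (\<lambda>_. 0) w"
  \<comment> \<open>\<open>c\<close> and \<open>d\<close> are the scalars by which the two old parts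
    fail to annihilate the new state. Subtracting \<open>c\<close> times \<open>anni n w\<close>
    repairs the first. The coefficient \<open>cnj d\<close> of the creator is harmless there, by
    exclusion, and becomes \<open>d\<close> times \<open>anni n w\<close> in the adjoint of the
    remainder.\<close>
  define p'' where "p'' = (\<lambda>i. p' i - c * cnj (w i))"
  define q'' where "q'' = (\<lambda>i. q' i + cnj d * w i)"
  have ac: "anni n w (crea n w \<psi>) = \<psi>"
    by (simp add: fun_eq_iff anni_crea w ann)
  have cc: "crea n w (crea n w \<psi>) = (\<lambda>_. 0)" by (rule crea_crea_same)
  have 1: "lop n p' q' (crea n w \<psi>) x = c * \<psi> x" for x
    using lop_anticommute[of n p' q' "\<lambda>_. 0" w \<psi> x] by (simp add: minus c_def crea_def)
  have 2: "lop n (\<lambda>i. cnj (q i - q' i)) (\<lambda>i. cnj (p i - p' i)) (crea n w \<psi>) x = d * \<psi> x" for x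
    using lop_anticommute[of n "\<lambda>i. cnj (q i - q' i)" "\<lambda>i. cnj (p i - p' i)" "\<lambda>_. 0" w \<psi> x]
    by (simp only: plus d_def crea_def lop_zero) simp
  have "lop n p'' q'' (crea n w \<psi>) x = 0" for x
  proof -
    have "lop n p'' q'' (crea n w \<psi>) x
       = lop n p' q' (crea n w \<psi>) x - c * anni n w (crea n w \<psi>) x + cnj d * crea n w (crea n w \<psi>) x"
      unfolding p''_def q''_def anni_def
      by (simp add: lop_def crea_def sum_distrib_left sum.distrib sum_subtractf algebra_simps)
    then show ?thesis unfolding 1 ac cc by simp
  qed
  moreover have "lop n (\<lambda>i. cnj (q i - q'' i)) (\<lambda>i. cnj (p i - p'' i)) (crea n w \<psi>) x = 0" for x
  proof -
    have "lop n (\<lambda>i. cnj (q i - q'' i)) (\<lambda>i. cnj (p i - p'' i)) (crea n w \<psi>) x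
       = lop n (\<lambda>i. cnj (q i - q' i)) (\<lambda>i. cnj (p i - p' i)) (crea n w \<psi>) x
         - d * anni n w (crea n w \<psi>) x + cnj c * crea n w (crea n w \<psi>) x"
      unfolding p''_def q''_def anni_def
      by (simp add: lop_def crea_def sum_distrib_left sum.distrib sum_subtractf algebra_simps)
    then show ?thesis unfolding 2 ac cc by simp
  qed
  ultimately show "\<exists>p' q'. lop n p' q' (crea n w \<psi>) = (\<lambda>_. 0) \<and>
     lop n (\<lambda>i. cnj (q i - q' i)) (\<lambda>i. cnj (p i - p' i)) (crea n w \<psi>) = (\<lambda>_. 0)"
    by (intro exI[of _ p''] exI[of _ q'']) (auto simp: fun_eq_iff)
qed

lemma quasifree_slater: "onlist n ws \<Longrightarrow> quasifree n (slater n ws)"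
  by (induction ws) (auto simp: quasifree_vac onlist_Cons intro!: quasifree_crea anni_slater)

definition fword :: "(nat \<times> bool) list \<Rightarrow> (nat \<Rightarrow> complex) \<Rightarrow> nat \<Rightarrow> complex" where
  "fword ops \<phi> = foldr (\<lambda>w. fop (snd w) (fst w)) ops \<phi>"

text \<open>Moving an operator rightwards through a word leaves one scalar contraction per letter
  and one sign per letter passed. The first conjunct pins \<open>g\<close> to these anticommutators,
  so that a user can identify \<open>g k\<close> with a two-point function.\<close>

lemma lop_fword:
  assumes "set (map fst ops) \<subseteq> {..<n}"
  shows "\<exists>g. (\<forall>k<length ops. \<forall>\<phi> x. lop n p q (fop (snd (ops ! k)) (fst (ops ! k)) \<phi>) x
               + fop (snd (ops ! k)) (fst (ops ! k)) (lop n p q \<phi>) x = g k * \<phi> x) \<and>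
     (\<forall>\<phi> x. lop n p q (fword ops \<phi>) x = (\<Sum>k<length ops. (-1) ^ k * g k * fword (take k ops @ drop (Suc k) ops) \<phi> x)
         + (-1) ^ length ops * fword ops (lop n p q \<phi>) x)"
  using assms
proof (induction ops)
  case Nil
  then show ?case by (auto simp: fword_def)
next
  case (Cons a ops)
  then obtain g where g: "\<forall>k<length ops. \<forall>\<phi> x. lop n p q (fop (snd (ops ! k)) (fst (ops ! k)) \<phi>) x
               + fop (snd (ops ! k)) (fst (ops ! k)) (lop n p q \<phi>) x = g k * \<phi> x"
    and IH: "\<And>\<phi> x. lop n p q (fword ops \<phi>) x = (\<Sum>k<length ops. (-1) ^ k * g k * fword (take k ops @ drop (Suc k) ops) \<phi> x)
         + (-1) ^ length ops * fword ops (lop n p q \<phi>) x" by auto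
  obtain j t where a: "a = (j, t)" by (cases a)
  have j: "j < n" using Cons.prems a by auto
  define c where "c = acomm n p q (\<lambda>i. of_bool (i = j \<and> \<not> t)) (\<lambda>i. of_bool (i = j \<and> t))"
  have c: "lop n p q (fop t j \<phi>) x + fop t j (lop n p q \<phi>) x = c * \<phi> x" for \<phi> x
    unfolding fop_eq_lop[OF j] c_def by (rule lop_anticommute)
  define g' where "g' k = (case k of 0 \<Rightarrow> c | Suc k \<Rightarrow> g k)" for k
  have "lop n p q (fop (snd ((a # ops) ! k)) (fst ((a # ops) ! k)) \<phi>) x
               + fop (snd ((a # ops) ! k)) (fst ((a # ops) ! k)) (lop n p q \<phi>) x = g' k * \<phi> x"
    if "k < length (a # ops)" for k \<phi> x
    using that g c by (cases k) (auto simp: a g'_def)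
  moreover have "lop n p q (fword (a # ops) \<phi>) x = (\<Sum>k<length (a # ops). (-1) ^ k * g' k * fword (take k (a # ops) @ drop (Suc k) (a # ops)) \<phi> x)
         + (-1) ^ length (a # ops) * fword (a # ops) (lop n p q \<phi>) x" for \<phi> x
  proof -
    have eq: "lop n p q (fword ops \<phi>) = (\<lambda>x. 1 * (\<Sum>k<length ops. (-1) ^ k * g k * fword (take k ops @ drop (Suc k) ops) \<phi> x)
         + (-1) ^ length ops * fword ops (lop n p q \<phi>) x)" using IH by (simp add: fun_eq_iff)
    have "lop n p q (fword (a # ops) \<phi>) x = c * fword ops \<phi> x - fop t j (lop n p q (fword ops \<phi>)) x"
      using c[of "fword ops \<phi>" x] by (simp add: a fword_def eq_diff_eq)
    also have "fop t j (lop n p q (fword ops \<phi>)) x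
        = (\<Sum>k<length ops. (-1) ^ k * g k * fop t j (fword (take k ops @ drop (Suc k) ops) \<phi>) x)
         + (-1) ^ length ops * fop t j (fword ops (lop n p q \<phi>)) x"
      unfolding eq fop_linear fop_sum fop_scale by simp
    finally show ?thesis
      by (simp add: sum.lessThan_Suc_shift g'_def fword_def a sum_negf[symmetric] del: sum.lessThan_Suc)
  qed
  ultimately show ?case by blast
qed

lemma quasifree_wick:
  assumes qf: "quasifree n \<psi>" and norm: "ip (2 ^ n) \<psi> \<psi> = 1" and ops: "set (map fst ops) \<subseteq> {..<n}"
  shows "ip (2 ^ n) (fword ops \<psi>) \<psi> = wick (\<lambda>ops. ip (2 ^ n) (fword ops \<psi>) \<psi>) ops"
  using ops
proof (induction "length ops" arbitrary: ops rule: less_induct)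
  case less
  show ?case
  proof (cases ops)
    case Nil
    then show ?thesis by (simp add: fword_def norm)
  next
    case (Cons a rest)
    obtain j t where a: "a = (j, t)" by (cases a)
    have j: "j < n" and rest: "set (map fst rest) \<subseteq> {..<n}" using less.prems Cons a by auto
    define p :: "nat \<Rightarrow> complex" where "p = (\<lambda>i. of_bool (i = j \<and> \<not> t))"
    define q :: "nat \<Rightarrow> complex" where "q = (\<lambda>i. of_bool (i = j \<and> t))"
    have fop: "fop t j = lop n p q" unfolding p_def q_def by (rule fop_eq_lop[OF j])
    obtain p' q' where minus: "lop n p' q' \<psi> = (\<lambda>_. 0)"
      and plus: "lop n (\<lambda>i. cnj (q i - q' i)) (\<lambda>i. cnj (p i - p' i)) \<psi> = (\<lambda>_. 0)"
      using qf unfolding quasifree_def by meson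
    \<comment> \<open>Moved to the other side of the inner product, the remainder acts on the state
      through its adjoint, which annihilates it. Only the annihilating part of the first letter
      survives.\<close>
    have replace: "ip (2 ^ n) (fop t j \<phi>) \<psi> = ip (2 ^ n) (lop n p' q' \<phi>) \<psi>" for \<phi>
    proof -
      have "fop t j \<phi> = (\<lambda>x. 1 * lop n p' q' \<phi> x + 1 * lop n (\<lambda>i. p i - p' i) (\<lambda>i. q i - q' i) \<phi> x)"
        unfolding fop by (simp add: lop_def fun_eq_iff sum.distrib sum_subtractf algebra_simps)
      then have "ip (2 ^ n) (fop t j \<phi>) \<psi> = ip (2 ^ n) (lop n p' q' \<phi>) \<psi>
         + ip (2 ^ n) (lop n (\<lambda>i. p i - p' i) (\<lambda>i. q i - q' i) \<phi>) \<psi>"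
        by (simp only: ip_linear_left) simp
      then show ?thesis by (simp only: lop_adjoint plus) simp
    qed
    obtain g where g: "\<And>k \<phi> x. k < length rest \<Longrightarrow> lop n p' q' (fop (snd (rest ! k)) (fst (rest ! k)) \<phi>) x
               + fop (snd (rest ! k)) (fst (rest ! k)) (lop n p' q' \<phi>) x = g k * \<phi> x"
      and exp: "\<And>\<phi> x. lop n p' q' (fword rest \<phi>) x
          = (\<Sum>k<length rest. (-1) ^ k * g k * fword (take k rest @ drop (Suc k) rest) \<phi> x)
           + (-1) ^ length rest * fword rest (lop n p' q' \<phi>) x"
      using lop_fword[OF rest, of p' q'] by blast
    have f0: "fop t' j' (\<lambda>_. 0) = (\<lambda>_. 0)" for t' j' by (simp add: fop_def fun_eq_iff)
    have fw0: "fword l (\<lambda>_. 0) = (\<lambda>_. 0)" for l by (induction l) (simp_all add: fword_def f0)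
    \<comment> \<open>The contractions are two-point functions: the case of a two-letter word, where
      the term that reaches the state vanishes and the norm is 1.\<close>
    have g2: "ip (2 ^ n) (fword [a, rest ! k] \<psi>) \<psi> = g k" if k: "k < length rest" for k
    proof -
      have "ip (2 ^ n) (fword [a, rest ! k] \<psi>) \<psi>
          = ip (2 ^ n) (lop n p' q' (fop (snd (rest ! k)) (fst (rest ! k)) \<psi>)) \<psi>"
        by (simp add: fword_def a replace)
      also have "lop n p' q' (fop (snd (rest ! k)) (fst (rest ! k)) \<psi>) = (\<lambda>x. g k * \<psi> x)"
        using g[OF k, of \<psi>] by (simp add: fun_eq_iff minus f0)
      finally show ?thesis by (simp add: ip_scale_left norm)
    qed
    have "ip (2 ^ n) (fword ops \<psi>) \<psi> = ip (2 ^ n) (lop n p' q' (fword rest \<psi>)) \<psi>"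
      by (simp add: Cons a fword_def replace)
    also have "lop n p' q' (fword rest \<psi>) = (\<lambda>x. \<Sum>k<length rest. ((-1) ^ k * g k) * fword (take k rest @ drop (Suc k) rest) \<psi> x)"
      by (simp add: fun_eq_iff exp minus fw0)
    also have "ip (2 ^ n) \<dots> \<psi> = (\<Sum>k<length rest. (-1) ^ k * g k * ip (2 ^ n) (fword (take k rest @ drop (Suc k) rest) \<psi>) \<psi>)"
      unfolding ip_sum_left ip_scale_left ..
    also have "\<dots> = (\<Sum>k<length rest. (-1) ^ k * ip (2 ^ n) (fword [a, rest ! k] \<psi>) \<psi>
        * wick (\<lambda>ops. ip (2 ^ n) (fword ops \<psi>) \<psi>) (take k rest @ drop (Suc k) rest))"
    proof (intro sum.cong refl)
      fix k assume "k \<in> {..<length rest}"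
      then have k: "k < length rest" by simp
      have "set (take k rest @ drop (Suc k) rest) \<subseteq> set rest"
        using set_take_subset[of k rest] set_drop_subset[of "Suc k" rest] by auto
      then have "set (map fst (take k rest @ drop (Suc k) rest)) \<subseteq> {..<n}"
        using rest by (simp only: set_map) blast
      then have "ip (2 ^ n) (fword (take k rest @ drop (Suc k) rest) \<psi>) \<psi>
         = wick (\<lambda>ops. ip (2 ^ n) (fword ops \<psi>) \<psi>) (take k rest @ drop (Suc k) rest)"
        using k Cons by (intro less.hyps) auto
      then show "(-1) ^ k * g k * ip (2 ^ n) (fword (take k rest @ drop (Suc k) rest) \<psi>) \<psi>
        = (-1) ^ k * ip (2 ^ n) (fword [a, rest ! k] \<psi>) \<psi>
        * wick (\<lambda>ops. ip (2 ^ n) (fword ops \<psi>) \<psi>) (take k rest @ drop (Suc k) rest)"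
        using g2[OF k] by simp
    qed
    \<comment> \<open>The case split is forced by the defining equations of \<open>wick\<close>,
      which treat one-letter words apart; there the sum is empty.\<close>
    also have "\<dots> = wick (\<lambda>ops. ip (2 ^ n) (fword ops \<psi>) \<psi>) ops"
      by (cases rest) (simp_all add: Cons)
    finally show ?thesis .
  qed
qed

section \<open>Quadratic operators\<close>

text \<open>Second quantisation of the one-particle matrix \<open>h\<close>.\<close>

definition quad :: "nat \<Rightarrow> (nat \<Rightarrow> nat \<Rightarrow> complex) \<Rightarrow> (nat \<Rightarrow> complex) \<Rightarrow> nat \<Rightarrow> complex" where
  "quad n h \<phi> x = (\<Sum>i<n. \<Sum>j<n. h i j * fop True i (fop False j \<phi>) x)"

lemma fop_crea:
  assumes "j < n"
  shows "fop False j (crea n w \<phi>) x = w j * \<phi> x - crea n w (fop False j \<phi>) x"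
  using lop_anticommute[of n "\<lambda>i. of_bool (i = j \<and> \<not> False)" "\<lambda>i. of_bool (i = j \<and> False)" "\<lambda>_. 0" w \<phi> x] assms
  unfolding fop_eq_lop[OF assms] crea_def by (simp add: acomm_def eq_diff_eq)

lemma fop_True_crea:
  assumes "j < n"
  shows "fop True j (crea n w \<phi>) x = - crea n w (fop True j \<phi>) x"
  using lop_anticommute[of n "\<lambda>i. of_bool (i = j \<and> \<not> True)" "\<lambda>i. of_bool (i = j \<and> True)" "\<lambda>_. 0" w \<phi> x]
  unfolding fop_eq_lop[OF assms] crea_def by (simp add: acomm_def eq_neg_iff_add_eq_0)

text \<open>The commutator of the second quantisation of \<open>h\<close> with the creator of
  \<open>w\<close> is the creator of \<open>h w\<close>. For an eigenvector this only adds its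
  energy.\<close>

lemma quad_crea:
  assumes "\<And>i. i < n \<Longrightarrow> (\<Sum>j<n. h i j * w j) = \<epsilon> * w i"
  shows "quad n h (crea n w \<phi>) x = \<epsilon> * crea n w \<phi> x + crea n w (quad n h \<phi>) x"
proof -
  have step: "fop True i (fop False j (crea n w \<phi>)) x
      = w j * fop True i \<phi> x + crea n w (fop True i (fop False j \<phi>)) x" if "i < n" "j < n" for i j
  proof -
    have "fop False j (crea n w \<phi>) = (\<lambda>x. w j * \<phi> x + (-1) * crea n w (fop False j \<phi>) x)"
      using fop_crea[OF that(2)] by (simp add: fun_eq_iff)
    then show ?thesis using that by (simp only: fop_linear) (simp add: fop_True_crea)
  qed
  have "quad n h (crea n w \<phi>) x
      = (\<Sum>i<n. \<Sum>j<n. h i j * (w j * fop True i \<phi> x)) + (\<Sum>i<n. \<Sum>j<n. h i j * crea n w (fop True i (fop False j \<phi>)) x)"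
    unfolding quad_def by (simp add: step distrib_left sum.distrib)
  also have "(\<Sum>i<n. \<Sum>j<n. h i j * (w j * fop True i \<phi> x)) = (\<Sum>i<n. (\<Sum>j<n. h i j * w j) * fop True i \<phi> x)"
    by (simp add: sum_distrib_right mult.assoc)
  also have "\<dots> = \<epsilon> * crea n w \<phi> x"
    by (simp add: assms crea_def lop_def sum_distrib_left mult.assoc)
  also have "(\<Sum>i<n. \<Sum>j<n. h i j * crea n w (fop True i (fop False j \<phi>)) x) = crea n w (quad n h \<phi>) x"
    unfolding quad_def[abs_def] crea_def lop_sum lop_scale ..
  finally show ?thesis .
qed

lemma quad_vac: "quad n h vac = (\<lambda>_. 0)"
proof -
  have "fop True i (\<lambda>_. 0) x = 0" for i x by (simp add: fop_def)
  then show ?thesis by (simp add: quad_def fun_eq_iff anni_fop_vac)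
qed

lemma quad_slater:
  assumes "\<And>k i. k \<in> set ks \<Longrightarrow> i < n \<Longrightarrow> (\<Sum>j<n. h i j * W k j) = \<epsilon> k * W k i"
  shows "quad n h (slater n (map W ks)) x = (\<Sum>k\<leftarrow>ks. \<epsilon> k) * slater n (map W ks) x"
  using assms
proof (induction ks arbitrary: x)
  case (Cons k ks)
  then have IH: "quad n h (slater n (map W ks)) = (\<lambda>x. (\<Sum>k\<leftarrow>ks. \<epsilon> k) * slater n (map W ks) x)"
    by (auto simp: fun_eq_iff)
  have "quad n h (crea n (W k) (slater n (map W ks))) x
      = \<epsilon> k * crea n (W k) (slater n (map W ks)) x + crea n (W k) (quad n h (slater n (map W ks))) x"
    by (rule quad_crea) (use Cons.prems in auto)
  also have "crea n (W k) (quad n h (slater n (map W ks))) x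
     = (\<Sum>k\<leftarrow>ks. \<epsilon> k) * crea n (W k) (slater n (map W ks)) x"
    unfolding IH crea_def lop_scale ..
  finally show ?case by (simp add: distrib_right)
qed (simp add: quad_vac)

section \<open>Bipartite amplitudes\<close>

type_synonym amp = "nat \<Rightarrow> nat \<Rightarrow> complex"

definition lopL :: "nat \<Rightarrow> (nat \<Rightarrow> complex) \<Rightarrow> (nat \<Rightarrow> complex) \<Rightarrow> amp \<Rightarrow> amp" where
  "lopL n p q K y z = lop n p q (\<lambda>y. K y z) y"

definition lopR :: "nat \<Rightarrow> (nat \<Rightarrow> complex) \<Rightarrow> (nat \<Rightarrow> complex) \<Rightarrow> amp \<Rightarrow> amp" where
  "lopR n p q K y z = lop n p q (K y) z"

text \<open>The fermion parity of the first factor, needed because operators on the second factor pass it.\<close>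

definition par :: "nat \<Rightarrow> amp \<Rightarrow> amp" where
  "par n K y z = jw_sign y n * K y z"

text \<open>\<open>tri n m K K K\<close> is the matrix product \<open>K K\<^sup>\<dagger> K\<close>; if it is a multiple of \<open>K\<close>, then
  \<open>K K\<^sup>\<dagger>\<close> is the same multiple of a projection.\<close>

definition tri :: "nat \<Rightarrow> nat \<Rightarrow> amp \<Rightarrow> amp \<Rightarrow> amp \<Rightarrow> amp" where
  "tri n m K1 K2 K3 y z = (\<Sum>y'<2 ^ n. \<Sum>z'<2 ^ m. K1 y z' * cnj (K2 y' z') * K3 y' z)"

text \<open>Hilbert-Schmidt inner product of amplitude matrices; on the diagonal it is the trace of
  the reduced state.\<close>

definition hs :: "nat \<Rightarrow> nat \<Rightarrow> amp \<Rightarrow> amp \<Rightarrow> complex" where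
  "hs n m K1 K2 = (\<Sum>y<2 ^ n. ip (2 ^ m) (K1 y) (K2 y))"

text \<open>At a fixed point an operator is a finite combination of evaluations. Hence an operator
  in the other variable commutes with it by linearity alone.\<close>

lemma lop_eq_eval: "\<exists>C f. \<forall>\<phi>. lop n p q \<phi> x = (\<Sum>a\<in>{..<n} \<times> (UNIV :: bool set). C a * \<phi> (f a))"
proof -
  define C where "C a = (if bit x (fst a) = snd a then (if snd a then q (fst a) else p (fst a)) * jw_sign x (fst a) else 0)" for a
  define f where "f a = flip_bit (fst a) x" for a :: "nat \<times> bool"
  have "\<forall>\<phi>. lop n p q \<phi> x = (\<Sum>a\<in>{..<n} \<times> UNIV. C a * \<phi> (f a))"
  proof
    fix \<phi> show "lop n p q \<phi> x = (\<Sum>a\<in>{..<n} \<times> UNIV. C a * \<phi> (f a))"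
    unfolding lop_eq_sum_pairs by (intro sum.cong) (auto simp: C_def f_def fop_def)
  qed
  then show ?thesis by (intro exI)
qed

lemma lopR_apply: "lopR n p q K y = lop n p q (K y)"
  by (rule ext) (simp add: lopR_def)

lemma lopL_lopR: "lopL n p q (lopR m p' q' K) = lopR m p' q' (lopL n p q K)"
proof (intro ext)
  fix y z
  obtain C f where *: "\<And>\<phi>. lop m p' q' \<phi> z = (\<Sum>a\<in>{..<m} \<times> (UNIV :: bool set). C a * \<phi> (f a))"
    using lop_eq_eval[of m p' q' z] by blast
  show "lopL n p q (lopR m p' q' K) y z = lopR m p' q' (lopL n p q K) y z"
    unfolding lopL_def lopR_def * lop_sum lop_scale ..
qed

text \<open>For \<open>i < n\<close> each \<open>fop\<close> flips exactly one of the bits counted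
  by \<open>jw_sign y n\<close>, so linear operators are odd.\<close>

lemma lop_parity:
  "lop n p q (\<lambda>y. jw_sign y n * \<phi> y) y = - jw_sign y n * lop n p q \<phi> y"
proof -
  have "fop t i (\<lambda>y. jw_sign y n * \<phi> y) y = - jw_sign y n * fop t i \<phi> y" if "i < n" for t i
    using that by (auto simp: fop_def jw_sign_flip_bit)
  then have "lop n p q (\<lambda>y. jw_sign y n * \<phi> y) y
      = (\<Sum>i<n. - jw_sign y n * (p i * fop False i \<phi> y + q i * fop True i \<phi> y))"
    unfolding lop_def by (intro sum.cong) (auto simp: algebra_simps)
  then show ?thesis by (simp only: lop_def sum_distrib_left)
qed

lemma lopL_par: "lopL n p q (par n K) = (\<lambda>y z. - par n (lopL n p q K) y z)"
  by (simp add: lopL_def par_def fun_eq_iff lop_parity)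

lemma lopR_par: "lopR m p q (par n K) = par n (lopR m p q K)"
  by (simp add: lopR_def par_def[abs_def] fun_eq_iff lop_scale)

lemma par_par [simp]: "par n (par n K) = K"
  by (simp add: par_def fun_eq_iff mult.assoc[symmetric])

lemma par_zero [simp]: "par n (\<lambda>_ _. 0) = (\<lambda>_ _. 0)"
  by (simp add: par_def fun_eq_iff)

lemma lopL_zero [simp]: "lopL n p q (\<lambda>_ _. 0) = (\<lambda>_ _. 0)"
  and lopR_zero [simp]: "lopR n p q (\<lambda>_ _. 0) = (\<lambda>_ _. 0)"
  by (simp_all add: lopL_def lopR_def fun_eq_iff)

lemma par_linear: "par n (\<lambda>y z. c * K y z + d * K' y z) = (\<lambda>y z. c * par n K y z + d * par n K' y z)"
  by (simp add: par_def fun_eq_iff algebra_simps)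

lemma lopL_linear: "lopL n p q (\<lambda>y z. c * K y z + d * K' y z) = (\<lambda>y z. c * lopL n p q K y z + d * lopL n p q K' y z)"
  and lopR_linear: "lopR n p q (\<lambda>y z. c * K y z + d * K' y z) = (\<lambda>y z. c * lopR n p q K y z + d * lopR n p q K' y z)"
  by (simp_all add: lopL_def lopR_def fun_eq_iff lop_linear)

lemma lopL_scale: "lopL n p q (\<lambda>y z. c * K y z) = (\<lambda>y z. c * lopL n p q K y z)"
  and lopR_scale: "lopR n p q (\<lambda>y z. c * K y z) = (\<lambda>y z. c * lopR n p q K y z)"
  by (simp_all add: lopL_def lopR_def fun_eq_iff lop_scale)

lemma par_scale: "par n (\<lambda>y z. c * K y z) = (\<lambda>y z. c * par n K y z)"
  by (simp add: par_def fun_eq_iff)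

lemma tri_linear1: "tri n m (\<lambda>y z. c * K y z + d * K' y z) K2 K3 = (\<lambda>y z. c * tri n m K K2 K3 y z + d * tri n m K' K2 K3 y z)"
  and tri_linear2: "tri n m K1 (\<lambda>y z. c * K y z + d * K' y z) K3 = (\<lambda>y z. cnj c * tri n m K1 K K3 y z + cnj d * tri n m K1 K' K3 y z)"
  and tri_linear3: "tri n m K1 K2 (\<lambda>y z. c * K y z + d * K' y z) = (\<lambda>y z. c * tri n m K1 K2 K y z + d * tri n m K1 K2 K' y z)"
  by (simp_all add: tri_def fun_eq_iff sum_distrib_left sum.distrib algebra_simps)

lemma tri_zero [simp]: "tri n m (\<lambda>_ _. 0) K2 K3 = (\<lambda>_ _. 0)" "tri n m K1 (\<lambda>_ _. 0) K3 = (\<lambda>_ _. 0)"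
  "tri n m K1 K2 (\<lambda>_ _. 0) = (\<lambda>_ _. 0)"
  by (simp_all add: tri_def fun_eq_iff)

lemma tri_lopL1: "tri n m (lopL n p q K1) K2 K3 = lopL n p q (tri n m K1 K2 K3)"
proof (intro ext)
  fix y z
  have "tri n m (lopL n p q K1) K2 K3 y z
     = (\<Sum>y'<2 ^ n. \<Sum>z'<2 ^ m. (cnj (K2 y' z') * K3 y' z) * lop n p q (\<lambda>y. K1 y z') y)"
    unfolding tri_def lopL_def by (intro sum.cong refl) (simp add: algebra_simps)
  also have "\<dots> = lop n p q (\<lambda>y. \<Sum>y'<2 ^ n. \<Sum>z'<2 ^ m. (cnj (K2 y' z') * K3 y' z) * K1 y z') y"
    unfolding lop_sum lop_scale ..
  also have "(\<lambda>y. \<Sum>y'<2 ^ n. \<Sum>z'<2 ^ m. (cnj (K2 y' z') * K3 y' z) * K1 y z') = (\<lambda>y. tri n m K1 K2 K3 y z)"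
    unfolding tri_def by (intro ext sum.cong refl) (simp add: algebra_simps)
  finally show "tri n m (lopL n p q K1) K2 K3 y z = lopL n p q (tri n m K1 K2 K3) y z"
    unfolding lopL_def .
qed

lemma tri_lopR3: "tri n m K1 K2 (lopR m p q K3) = lopR m p q (tri n m K1 K2 K3)"
proof (intro ext)
  fix y z
  have "tri n m K1 K2 (lopR m p q K3) y z
     = (\<Sum>y'<2 ^ n. \<Sum>z'<2 ^ m. (K1 y z' * cnj (K2 y' z')) * lop m p q (K3 y') z)"
    unfolding tri_def lopR_def ..
  also have "\<dots> = lop m p q (\<lambda>z. \<Sum>y'<2 ^ n. \<Sum>z'<2 ^ m. (K1 y z' * cnj (K2 y' z')) * K3 y' z) z"
    unfolding lop_sum lop_scale ..
  finally show "tri n m K1 K2 (lopR m p q K3) y z = lopR m p q (tri n m K1 K2 K3) y z"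
    unfolding lopR_def tri_def[abs_def] .
qed

lemma tri_eq_ip_left: "tri n m K1 K2 K3 y z = (\<Sum>y'<2 ^ n. ip (2 ^ m) (K1 y) (K2 y') * K3 y' z)"
  by (simp add: tri_def ip_def sum_distrib_right)

lemma tri_eq_ip_right: "tri n m K1 K2 K3 y z = (\<Sum>z'<2 ^ m. K1 y z' * ip (2 ^ n) (\<lambda>y'. K3 y' z) (\<lambda>y'. K2 y' z'))"
  unfolding tri_def ip_def sum_distrib_left by (subst sum.swap) (simp add: algebra_simps)

text \<open>The middle factor shares its row index with the third factor and its column index with
  the first. Adjoints of row operators therefore land on the third factor and those of column
  operators on the first.\<close>

lemma tri_lopL2: "tri n m K1 (lopL n p q K2) K3 = tri n m K1 K2 (lopL n (\<lambda>i. cnj (q i)) (\<lambda>i. cnj (p i)) K3)"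
  by (simp add: fun_eq_iff tri_eq_ip_right lopL_def lop_adjoint)

lemma tri_lopR2: "tri n m K1 (lopR m p q K2) K3 = tri n m (lopR m (\<lambda>i. cnj (q i)) (\<lambda>i. cnj (p i)) K1) K2 K3"
  by (simp add: fun_eq_iff tri_eq_ip_left lopR_apply lop_adjoint)

lemma tri_par1: "tri n m (par k K1) K2 K3 = par k (tri n m K1 K2 K3)"
  and tri_par2: "tri n m K1 (par k K2) K3 = tri n m K1 K2 (par k K3)"
  by (simp_all add: tri_def par_def fun_eq_iff sum_distrib_left algebra_simps)

lemma hs_lopR: "hs n m (lopR m p q K1) K2 = hs n m K1 (lopR m (\<lambda>i. cnj (q i)) (\<lambda>i. cnj (p i)) K2)"
  by (simp add: hs_def lopR_apply lop_adjoint)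

lemma hs_swap: "hs n m K1 K2 = (\<Sum>z<2 ^ m. ip (2 ^ n) (\<lambda>y. K1 y z) (\<lambda>y. K2 y z))"
  unfolding hs_def ip_def by (rule sum.swap)

lemma hs_lopL: "hs n m (lopL n p q K1) K2 = hs n m K1 (lopL n (\<lambda>i. cnj (q i)) (\<lambda>i. cnj (p i)) K2)"
  by (simp add: hs_swap lopL_def[abs_def] lop_adjoint)

lemma hs_par: "hs n m (par k K1) K2 = hs n m K1 (par k K2)"
  by (simp add: hs_def ip_def par_def algebra_simps)

lemma hs_linear1: "hs n m (\<lambda>y z. c * K y z + d * K' y z) K2 = c * hs n m K K2 + d * hs n m K' K2"
  by (simp add: hs_def ip_linear_left sum.distrib sum_distrib_left)

lemma hs_linear2: "hs n m K2 (\<lambda>y z. c * K y z + d * K' y z) = cnj c * hs n m K2 K + cnj d * hs n m K2 K'"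
  by (simp add: hs_def ip_linear_right sum.distrib sum_distrib_left)

lemma hs_zero [simp]: "hs n m (\<lambda>_ _. 0) K = 0" "hs n m K (\<lambda>_ _. 0) = 0"
  by (simp_all add: hs_def)

section \<open>The invariant of the amplitude matrix\<close>

abbreviation "cL n w \<equiv> lopL n (\<lambda>_. 0) w"
abbreviation "aL n w \<equiv> lopL n (\<lambda>i. cnj (w i)) (\<lambda>_. 0)"
abbreviation "cR n w \<equiv> lopR n (\<lambda>_. 0) w"
abbreviation "aR n w \<equiv> lopR n (\<lambda>i. cnj (w i)) (\<lambda>_. 0)"

lemma aL_cL: "aL n w (cL n w' K) = (\<lambda>y z. ip n w' w * K y z - cL n w' (aL n w K) y z)"
  using anni_crea[of n w w'] by (simp add: lopL_def fun_eq_iff anni_def crea_def)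

lemma aR_cR: "aR n w (cR n w' K) = (\<lambda>y z. ip n w' w * K y z - cR n w' (aR n w K) y z)"
  using anni_crea[of n w w'] by (simp add: lopR_apply fun_eq_iff anni_def crea_def)

lemma cL_cL: "cL n w (cL n w K) = (\<lambda>_ _. 0)"
  using crea_crea_same[of n w] by (simp add: lopL_def fun_eq_iff crea_def)

lemma cR_cR: "cR n w (cR n w K) = (\<lambda>_ _. 0)"
  using crea_crea_same[of n w] by (simp add: lopR_apply fun_eq_iff crea_def)

text \<open>\<open>c\<close> is the only possible nonzero eigenvalue of the reduced state, whose
  trace is 1. \<open>V\<close> and \<open>U\<close> list the row and column modes that are still
  empty and hence available for later creation steps.\<close>

definition ent_inv :: "nat \<Rightarrow> nat \<Rightarrow> complex \<Rightarrow> (nat \<Rightarrow> complex) set \<Rightarrow> (nat \<Rightarrow> complex) set \<Rightarrow> amp \<Rightarrow> bool" where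
  "ent_inv n m c V U K \<longleftrightarrow> tri n m K K K = (\<lambda>y z. c * K y z) \<and> hs n m K K = 1 \<and>
     (\<forall>v\<in>V. aL n v K = (\<lambda>_ _. 0)) \<and> (\<forall>u\<in>U. aR m u K = (\<lambda>_ _. 0))"

lemma ent_invD:
  assumes "ent_inv n m c V U K"
  shows "tri n m K K K = (\<lambda>y z. c * K y z)" "hs n m K K = 1"
    "\<And>v. v \<in> V \<Longrightarrow> aL n v K = (\<lambda>_ _. 0)" "\<And>u. u \<in> U \<Longrightarrow> aR m u K = (\<lambda>_ _. 0)"
  using assms unfolding ent_inv_def by auto

lemma ent_inv_mono: "ent_inv n m c V U K \<Longrightarrow> V' \<subseteq> V \<Longrightarrow> U' \<subseteq> U \<Longrightarrow> ent_inv n m c V' U' K"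
  unfolding ent_inv_def by auto

lemma tri_cL:
  assumes "aL n v K = (\<lambda>_ _. 0)" "ip n v v = 1"
  shows "tri n m (cL n v K) (cL n v K) (cL n v K) = cL n v (tri n m K K K)"
  by (simp add: tri_lopL1 tri_lopL2 aL_cL assms)

lemma tri_cR:
  assumes "aR m u K = (\<lambda>_ _. 0)" "ip m u u = 1"
  shows "tri n m (par n (cR m u K)) (par n (cR m u K)) (par n (cR m u K)) = par n (cR m u (tri n m K K K))"
  by (simp add: tri_par1 tri_par2 tri_lopR2 tri_lopR3 lopR_par aR_cR assms)

text \<open>Occupying an empty mode inside one factor is isometric on the states in question, so
  \<open>c\<close> is kept.\<close>

lemma ent_inv_cL:
  assumes inv: "ent_inv n m c V U K" and v: "v \<in> V" "ip n v v = 1" and V': "V' \<subseteq> V" "\<forall>v'\<in>V'. ip n v v' = 0"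
  shows "ent_inv n m c V' U (cL n v K)"
  unfolding ent_inv_def
proof (intro conjI ballI)
  note inv = ent_invD[OF inv]
  note 0 = inv(3)[OF v(1)]
  show "tri n m (cL n v K) (cL n v K) (cL n v K) = (\<lambda>y z. c * cL n v K y z)"
    by (simp add: tri_cL 0 v inv lopL_scale)
  show "hs n m (cL n v K) (cL n v K) = 1"
    by (simp add: hs_lopL aL_cL 0 v inv)
  show "aL n v' (cL n v K) = (\<lambda>_ _. 0)" if "v' \<in> V'" for v'
    using that V' inv(3)[of v'] by (auto simp: aL_cL)
  show "aR m u (cL n v K) = (\<lambda>_ _. 0)" if "u \<in> U" for u
    by (simp add: lopL_lopR[symmetric] inv(4)[OF that])
qed

lemma ent_inv_cR:
  assumes inv: "ent_inv n m c V U K" and u: "u \<in> U" "ip m u u = 1" and U': "U' \<subseteq> U" "\<forall>u'\<in>U'. ip m u u' = 0"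
  shows "ent_inv n m c V U' (par n (cR m u K))"
  unfolding ent_inv_def
proof (intro conjI ballI)
  note inv = ent_invD[OF inv]
  note 0 = inv(4)[OF u(1)]
  show "tri n m (par n (cR m u K)) (par n (cR m u K)) (par n (cR m u K)) = (\<lambda>y z. c * par n (cR m u K) y z)"
    by (simp add: tri_cR 0 u inv lopR_scale par_scale)
  show "hs n m (par n (cR m u K)) (par n (cR m u K)) = 1"
    by (simp add: hs_lopR hs_par aR_cR 0 u inv)
  show "aL n v' (par n (cR m u K)) = (\<lambda>_ _. 0)" if "v' \<in> V" for v'
    by (simp add: lopL_par lopL_lopR inv(3)[OF that])
  show "aR m u' (par n (cR m u K)) = (\<lambda>_ _. 0)" if "u' \<in> U'" for u'
    using that U' inv(4)[of u'] by (auto simp: lopR_par aR_cR)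
qed

text \<open>Of the eight terms of the cubic expansion only the two pure ones survive, with weights
  \<open>s * s * s = s / 2\<close> and \<open>t * t * t = t / 2\<close>; this is where
  \<open>c\<close> is halved. Both signs of the coefficients are allowed so that either hybrid of a
  pair is covered.\<close>

lemma ent_inv_mix:
  assumes inv: "ent_inv n m c V U K" and u: "u \<in> U" "ip m u u = 1" and U': "U' \<subseteq> U" "\<forall>u'\<in>U'. ip m u u' = 0"
    and v: "v \<in> V" "ip n v v = 1" and V': "V' \<subseteq> V" "\<forall>v'\<in>V'. ip n v v' = 0"
    and st: "cnj s = s" "cnj t = t" "s * s = 1 / 2" "t * t = 1 / 2"
  shows "ent_inv n m (c / 2) V' U' (\<lambda>y z. s * cL n v K y z + t * par n (cR m u K) y z)"
  unfolding ent_inv_def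
proof (intro conjI ballI)
  note inv = ent_invD[OF inv]
  note 0 = inv(3)[OF v(1)] inv(4)[OF u(1)]
  let ?b = "cL n v K" and ?a = "par n (cR m u K)"
  have aLb: "aL n v ?b = K" by (simp add: aL_cL 0 v)
  have aLa: "aL n v ?a = (\<lambda>_ _. 0)" by (simp add: lopL_par lopL_lopR 0)
  have aRa: "aR m u (cR m u K) = K" by (simp add: aR_cR 0 u)
  have aRb: "aR m u ?b = (\<lambda>_ _. 0)" by (simp add: lopL_lopR[symmetric] 0)
  have bbb: "tri n m ?b ?b ?b = (\<lambda>y z. c * ?b y z)"
    by (simp add: tri_cL 0 v inv lopL_scale)
  have aaa: "tri n m ?a ?a ?a = (\<lambda>y z. c * ?a y z)"
    by (simp add: tri_cR 0 u inv lopR_scale par_scale)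
  \<comment> \<open>In a mixed term two neighbouring factors differ. Factors one and two are
    contracted over columns, where the occupation of \<open>u\<close> differs; factors two and three
    over rows, where that of \<open>v\<close> differs. Either contraction is zero.\<close>
  have x_b_a: "tri n m X ?b ?a = (\<lambda>_ _. 0)" for X
    by (simp add: tri_lopL2 aLa)
  have b_a_x: "tri n m ?b ?a X = (\<lambda>_ _. 0)" for X
    by (simp add: tri_par2 tri_lopR2 aRb)
  have abb: "tri n m ?a ?b ?b = (\<lambda>_ _. 0)"
  proof -
    have "tri n m ?a ?b ?b = par n (tri n m (cR m u K) K K)" by (simp add: tri_lopL2 aLb tri_par1)
    also have "tri n m (cR m u K) K K = tri n m K (aR m u K) K" by (simp add: tri_lopR2)
    finally show ?thesis by (simp add: 0)
  qed
  have aab: "tri n m ?a ?a ?b = (\<lambda>_ _. 0)"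
  proof -
    have "tri n m ?a ?a ?b = par n (tri n m K K (par n ?b))"
      by (simp add: tri_par1 tri_par2 tri_lopR2 lopR_par aRa)
    also have "par n ?b = (\<lambda>y z. - cL n v (par n K) y z)"
      by (simp add: lopL_par)
    also have "\<dots> = (\<lambda>y z. (-1) * cL n v (par n K) y z + 0 * K y z)" by simp
    also have "tri n m K K \<dots> = (\<lambda>y z. (-1) * tri n m K K (cL n v (par n K)) y z)"
      by (simp only: tri_linear3) simp
    also have "tri n m K K (cL n v (par n K)) = tri n m K (aL n v K) (par n K)"
      by (simp add: tri_lopL2)
    finally show ?thesis by (simp add: 0)
  qed
  have sss: "s * (s * (s * x)) = (1 / 2) * (s * x)" and "t * (t * (t * x)) = (1 / 2) * (t * x)" for x
    using st by (simp_all only: mult.assoc[symmetric]) simp_all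
  moreover have st2: "s * (s * 2) = 1" "t * (t * 2) = 1"
    using st by (simp_all flip: mult.assoc)
  ultimately show "tri n m (\<lambda>y z. s * ?b y z + t * ?a y z) (\<lambda>y z. s * ?b y z + t * ?a y z) (\<lambda>y z. s * ?b y z + t * ?a y z)
      = (\<lambda>y z. c / 2 * (s * ?b y z + t * ?a y z))"
    by (simp add: tri_linear1 tri_linear2 tri_linear3 st bbb aaa x_b_a b_a_x abb aab fun_eq_iff algebra_simps sss st2)
  have "hs n m ?b ?b = 1" by (simp add: hs_lopL aLb inv)
  moreover have "hs n m ?a ?a = 1" by (simp add: hs_par hs_lopR aRa inv)
  moreover have "hs n m ?b ?a = 0" by (simp add: hs_lopL aLa)
  moreover have "hs n m ?a ?b = 0"
  proof -
    have "hs n m K (aL n v ?a) = 0" by (simp add: aLa)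
    then show ?thesis using hs_lopL[of n m "\<lambda>i. cnj (v i)" "\<lambda>_. 0" ?a K] by (simp add: aLa)
  qed
  ultimately show "hs n m (\<lambda>y z. s * ?b y z + t * ?a y z) (\<lambda>y z. s * ?b y z + t * ?a y z) = 1"
    by (simp add: hs_linear1 hs_linear2 st)
  show "aL n v' (\<lambda>y z. s * ?b y z + t * ?a y z) = (\<lambda>_ _. 0)" if "v' \<in> V'" for v'
    using that V' inv(3)[of v'] by (auto simp: lopL_linear aL_cL lopL_par lopL_lopR)
  show "aR m u' (\<lambda>y z. s * ?b y z + t * ?a y z) = (\<lambda>_ _. 0)" if "u' \<in> U'" for u'
    using that U' inv(4)[of u'] by (auto simp: lopR_linear aR_cR lopR_par lopL_lopR[symmetric])
qed

text \<open>Filling both hybrids equals filling both constituents. The squares vanish by exclusion,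
  and the two cross terms agree, because the parity factor anticommutes with the row creator;
  together they weigh \<open>2 * s * s = 1\<close>.\<close>

lemma double_mix:
  fixes s :: complex
  assumes st: "s * s = 1 / 2"
    and F: "\<And>t K. F t K = (\<lambda>y z. s * cL n v K y z + t * par n (cR m u K) y z)"
  shows "F s (F (- s) K) = par n (cR m u (cL n v K))"
proof -
  have ss: "s * (s * x) = x / 2" for x using st by (simp only: mult.assoc[symmetric]) simp
  show ?thesis
    unfolding F lopL_linear lopR_linear par_linear cL_cL cR_cR lopL_par lopR_par par_par lopL_lopR
    by (simp add: fun_eq_iff algebra_simps ss)
qed

section \<open>Singular value decomposition\<close>

definition mv :: "nat \<Rightarrow> (nat \<Rightarrow> nat \<Rightarrow> complex) \<Rightarrow> (nat \<Rightarrow> complex) \<Rightarrow> nat \<Rightarrow> complex" where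
  "mv s Y v i = (\<Sum>j<s. Y i j * v j)"

definition adj :: "(nat \<Rightarrow> nat \<Rightarrow> complex) \<Rightarrow> nat \<Rightarrow> nat \<Rightarrow> complex" where
  "adj Y i j = cnj (Y j i)"

lemma adj_adj [simp]: "adj (adj Y) = Y"
  by (simp add: adj_def fun_eq_iff)

lemma mv_adjoint: "ip r (mv s Y v) w = ip s v (mv r (adj Y) w)"
  unfolding ip_def mv_def adj_def
  by (simp add: sum_distrib_left sum_distrib_right sum.swap[of _ "{..<r}"] algebra_simps)

lemma ip_cong: "(\<And>i. i < n \<Longrightarrow> u i = u' i) \<Longrightarrow> (\<And>i. i < n \<Longrightarrow> v i = v' i) \<Longrightarrow> ip n u v = ip n u' v'"
  unfolding ip_def by (intro sum.cong) auto

lemma ip_self: "ip n v v = complex_of_real (\<Sum>i<n. (cmod (v i))\<^sup>2)"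
  by (simp add: ip_def flip: complex_norm_square)

lemma ip_self_eq_0: "ip n v v = 0 \<longleftrightarrow> (\<forall>i<n. v i = 0)"
  by (simp only: ip_self of_real_eq_0_iff) (auto simp: sum_nonneg_eq_0_iff)

definition onb :: "nat \<Rightarrow> (nat \<Rightarrow> nat \<Rightarrow> complex) \<Rightarrow> bool" where
  "onb n p \<longleftrightarrow> (\<forall>k<n. \<forall>l<n. ip n (p k) (p l) = of_bool (k = l))"

lemma scalar_prod_conjugate_vec: "vec n u \<bullet>c vec n v = ip n u v"
  unfolding scalar_prod_def ip_def by (auto intro!: sum.cong)

text \<open>Orthonormality says that a square matrix has a right inverse; that inverse is two-sided,
  and the reversed product is the completeness relation.\<close>

lemma onb_completeness:
  assumes "onb n p" and "i < n" and "j < n"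
  shows "(\<Sum>k<n. p k i * cnj (p k j)) = of_bool (i = j)"
proof -
  define P where "P = mat n n (\<lambda>(k, i). p k i)"
  define Q where "Q = mat n n (\<lambda>(i, k). cnj (p k i))"
  have PQ: "P \<in> carrier_mat n n" "Q \<in> carrier_mat n n" by (auto simp: P_def Q_def)
  have "P * Q = 1\<^sub>m n"
  proof (intro eq_matI)
    fix k l assume "k < dim_row (1\<^sub>m n)" "l < dim_col (1\<^sub>m n)"
    then have kl: "k < n" "l < n" by auto
    then have "(P * Q) $$ (k, l) = ip n (p k) (p l)"
      by (auto simp: P_def Q_def scalar_prod_def ip_def intro!: sum.cong)
    then show "(P * Q) $$ (k, l) = 1\<^sub>m n $$ (k, l)" using kl assms(1) by (simp add: onb_def)
  qed (simp_all add: P_def Q_def)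
  then have "Q * P = 1\<^sub>m n" by (rule mat_mult_left_right_inverse[OF PQ])
  then have "(Q * P) $$ (j, i) = of_bool (i = j)" using assms by auto
  moreover have "(Q * P) $$ (j, i) = (\<Sum>k<n. p k i * cnj (p k j))"
    using assms by (auto simp: P_def Q_def scalar_prod_def mult.commute lessThan_atLeast0 intro!: sum.cong)
  ultimately show ?thesis by simp
qed

lemma onb_expand:
  assumes "onb n p" and "i < n"
  shows "w i = (\<Sum>k<n. ip n w (p k) * p k i)"
proof -
  have "(\<Sum>k<n. ip n w (p k) * p k i) = (\<Sum>k<n. \<Sum>j<n. w j * (p k i * cnj (p k j)))"
    by (simp add: ip_def sum_distrib_right sum_distrib_left algebra_simps)
  also have "\<dots> = (\<Sum>j<n. w j * (\<Sum>k<n. p k i * cnj (p k j)))"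
    unfolding sum_distrib_left by (rule sum.swap)
  also have "\<dots> = (\<Sum>j<n. w j * of_bool (i = j))"
    using onb_completeness[OF assms(1,2)] by (intro sum.cong) auto
  also have "\<dots> = w i" using assms(2) by (simp add: of_bool_def if_distrib cong: if_cong)
  finally show ?thesis ..
qed

lemma onb_extend:
  assumes v: "ip n v v = 1"
  shows "\<exists>p. onb n p \<and> p 0 = v"
proof -
  let ?v = "vec n v"
  have v0: "?v \<noteq> 0\<^sub>v n"
  proof
    assume "?v = 0\<^sub>v n"
    then have "?v \<bullet>c ?v = 0" by simp
    then show False using v by (simp add: scalar_prod_conjugate_vec)
  qed
  have n: "n \<noteq> 0" using v by (cases n) (auto simp: ip_def)
  interpret cof_vec_space n "TYPE(complex)" .
  define b where "b = basis_completion ?v"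
  define ws where "ws = gram_schmidt n b"
  note bc = basis_completion[OF vec_carrier v0, folded b_def]
  obtain vs where bv: "b = ?v # vs" using bc(6,7) n by (cases b) auto
  from gram_schmidt_result[OF bc(2,4,5) refl, folded ws_def] bc(6)
  have ws: "set ws \<subseteq> carrier_vec n" "corthogonal ws" "length ws = n" by auto
  from gram_schmidt_hd[OF vec_carrier[of n v], of vs, folded bv] have hd: "hd ws = ?v" unfolding ws_def .
  then have ws0: "ws ! 0 = ?v" using n ws(3) by (metis hd_conv_nth length_0_conv)
  define w where "w k i = ws ! k $ i" for k i
  have orth: "(ip n (w k) (w l) = 0) = (k \<noteq> l)" if "k < n" "l < n" for k l
  proof -
    have "ws ! k \<in> carrier_vec n" "ws ! l \<in> carrier_vec n" using ws that by auto
    then have "vec n (w k) = ws ! k" "vec n (w l) = ws ! l" by (auto simp: w_def)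
    then show ?thesis using corthogonalD[OF ws(2), of k l] that ws(3)
      by (simp flip: scalar_prod_conjugate_vec)
  qed
  define r where "r k = sqrt (\<Sum>i<n. (cmod (w k i))\<^sup>2)" for k
  have r: "complex_of_real (r k) * complex_of_real (r k) = ip n (w k) (w k)" for k
    by (simp add: ip_self r_def flip: of_real_mult) (simp add: sum_nonneg)
  \<comment> \<open>Index 0 keeps \<open>v\<close> itself, since the Gram-Schmidt vector agrees with
    it only below \<open>n\<close> while \<open>p 0 = v\<close> is an equality of functions.\<close>
  define p where "p k = (if k = 0 then v else (\<lambda>i. inverse (complex_of_real (r k)) * w k i))" for k
  have w0: "w 0 i = v i" if "i < n" for i using that by (simp add: w_def ws0)
  have ip_w0: "ip n (w 0) x = ip n v x" "ip n x (w 0) = ip n x v" for x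
    by (auto intro!: ip_cong simp: w0)
  have "ip n (p k) (p l) = of_bool (k = l)" if kl: "k < n" "l < n" for k l
  proof (cases "k = l")
    case False
    then have "ip n (w k) (w l) = 0" using orth[OF kl] by simp
    then show ?thesis using False
      by (auto simp: p_def ip_scale_left ip_scale_right ip_w0 split: if_splits)
  next
    case True
    then have "ip n (w k) (w k) \<noteq> 0" using orth[OF kl] by simp
    then have "complex_of_real (r k) \<noteq> 0" using r[of k] by auto
    then have "inverse (complex_of_real (r k)) * (inverse (complex_of_real (r k)) * ip n (w k) (w k)) = 1"
      unfolding r[symmetric] by (simp add: field_simps)
    then show ?thesis using True v
      by (auto simp: p_def ip_scale_left ip_scale_right)
  qed
  then have "onb n p" by (simp add: onb_def)
  moreover have "p 0 = v" by (simp add: p_def)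
  ultimately show ?thesis by blast
qed

lemma normalize:
  assumes "\<exists>i<n. w i \<noteq> 0"
  shows "\<exists>c. c \<noteq> 0 \<and> ip n (\<lambda>i. c * w i) (\<lambda>i. c * w i) = 1"
proof -
  define s where "s = (\<Sum>i<n. (cmod (w i))\<^sup>2)"
  have "ip n w w \<noteq> 0" using assms ip_self_eq_0[of n w] by blast
  then have "s \<noteq> 0" unfolding ip_self s_def[symmetric] by simp
  moreover have "s \<ge> 0" by (simp add: s_def sum_nonneg)
  ultimately have s: "s > 0" by simp
  define c where "c = complex_of_real (inverse (sqrt s))"
  have "inverse (sqrt s) * (inverse (sqrt s) * s) = 1"
    using s by (simp add: field_simps real_sqrt_mult_self flip: power2_eq_square)
  then have "c * (c * ip n w w) = 1"
    unfolding c_def ip_self s_def[symmetric] by (simp only: of_real_mult[symmetric]) simp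
  moreover have "c \<noteq> 0" using s by (simp add: c_def)
  moreover have "cnj c = c" by (simp add: c_def)
  ultimately show ?thesis by (intro exI[of _ c]) (simp add: ip_scale_left ip_scale_right)
qed

lemma mv_scale: "mv n T (\<lambda>i. c * v i) i = c * mv n T v i"
  by (simp add: mv_def sum_distrib_left algebra_simps)

lemma mult_mat_vec_eq_mv: "mat r n (\<lambda>(i, j). T i j) *\<^sub>v vec n v = vec r (mv n T v)"
  by (intro eq_vecI) (auto simp: mv_def scalar_prod_def lessThan_atLeast0 intro!: sum.cong)

lemma exists_unit_eigenvector:
  assumes "n > 0"
  shows "\<exists>v l. ip n v v = 1 \<and> (\<forall>i<n. mv n T v i = l * v i)"
proof -
  define A where "A = mat n n (\<lambda>(i, j). T i j)"
  have A: "A \<in> carrier_mat n n" by (simp add: A_def)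
  obtain as where as: "char_poly A = (\<Prod>a\<leftarrow>as. [:- a, 1:])" "length as = n"
    using char_poly_factorized[OF A] by blast
  then obtain l where "l \<in> set as" using assms by (cases as) auto
  then have "poly (char_poly A) l = 0"
    unfolding as by (auto simp: poly_prod_list prod_list_zero_iff o_def)
  then have "eigenvalue A l" by (simp add: eigenvalue_root_char_poly[OF A])
  then obtain w where w: "w \<in> carrier_vec n" "w \<noteq> 0\<^sub>v n" "A *\<^sub>v w = l \<cdot>\<^sub>v w"
    unfolding eigenvalue_def eigenvector_def using A by auto
  have ww: "w = vec n (\<lambda>i. w $ i)" using w(1) by auto
  have "\<exists>i<n. w $ i \<noteq> 0"
    using w(1,2) by (metis carrier_vecD eq_vecI index_zero_vec(1) index_zero_vec(2))
  then obtain c where c: "ip n (\<lambda>i. c * w $ i) (\<lambda>i. c * w $ i) = 1" using normalize by blast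
  have "mv n T (\<lambda>i. w $ i) i = l * w $ i" if "i < n" for i
  proof -
    have "(A *\<^sub>v w) $ i = mv n T (\<lambda>i. w $ i) i"
      using that by (subst ww) (simp add: A_def mult_mat_vec_eq_mv)
    then show ?thesis using w that by simp
  qed
  then show ?thesis using c
    by (intro exI[of _ "\<lambda>i. c * w $ i"] exI[of _ l]) (simp add: mv_scale)
qed

text \<open>Serves the singular value 0, where \<open>X v = 0\<close> offers no direction for a left
  singular vector. Since \<open>n \<le> m\<close> and X has a kernel, its adjoint must have one
  too.\<close>

lemma exists_unit_left_null:
  assumes nm: "n \<le> m" and v: "ip n v v = 1" and Xv: "\<And>i. i < m \<Longrightarrow> mv n X v i = 0"
  shows "\<exists>u. ip m u u = 1 \<and> (\<forall>j<n. mv m (adj X) u j = 0)"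
proof -
  \<comment> \<open>Padding the adjoint to a square matrix turns the right null vector into a left one.\<close>
  define Y where "Y = mat m m (\<lambda>(i, j). if i < n then cnj (X j i) else 0)"
  define v' where "v' = vec m (\<lambda>i. if i < n then cnj (v i) else 0)"
  have Y: "Y \<in> carrier_mat m m" by (simp add: Y_def)
  have "transpose_mat Y *\<^sub>v v' = 0\<^sub>v m"
  proof (intro eq_vecI)
    fix i assume "i < dim_vec (0\<^sub>v m)"
    then have i: "i < m" by simp
    have "(transpose_mat Y *\<^sub>v v') $ i = (\<Sum>j\<in>{..<m}. if j < n then cnj (X i j * v j) else 0)"
      using i by (auto simp: Y_def v'_def scalar_prod_def lessThan_atLeast0 intro!: sum.cong)
    also have "\<dots> = (\<Sum>j\<in>{..<n}. cnj (X i j * v j))"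
      using nm by (intro sum.mono_neutral_cong_right) auto
    also have "\<dots> = cnj (mv n X v i)" by (simp add: mv_def)
    finally show "(transpose_mat Y *\<^sub>v v') $ i = 0\<^sub>v m $ i" using Xv[OF i] i by simp
  qed (simp add: Y_def)
  moreover have "v' \<noteq> 0\<^sub>v m"
  proof
    assume "v' = 0\<^sub>v m"
    then have "v i = 0" if "i < n" for i
    proof -
      have "v' $ i = 0" using \<open>v' = 0\<^sub>v m\<close> that nm by simp
      then show ?thesis using that nm by (simp add: v'_def)
    qed
    then show False using v ip_self_eq_0[of n v] by simp
  qed
  moreover have "v' \<in> carrier_vec m" by (simp add: v'_def)
  ultimately have "det (transpose_mat Y) = 0"
    using det_0_iff_vec_prod_zero[of "transpose_mat Y" m] Y by auto
  then have "det Y = 0" by (simp add: det_transpose[OF Y])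
  then obtain w where w: "w \<in> carrier_vec m" "w \<noteq> 0\<^sub>v m" "Y *\<^sub>v w = 0\<^sub>v m"
    using det_0_iff_vec_prod_zero[OF Y] by auto
  have "\<exists>i<m. w $ i \<noteq> 0"
    using w(1,2) by (metis carrier_vecD eq_vecI index_zero_vec(1) index_zero_vec(2))
  then obtain c where c: "ip m (\<lambda>i. c * w $ i) (\<lambda>i. c * w $ i) = 1" using normalize by blast
  have "mv m (adj X) (\<lambda>i. w $ i) j = 0" if "j < n" for j
  proof -
    have "(Y *\<^sub>v w) $ j = mv m (adj X) (\<lambda>i. w $ i) j"
      using that nm w(1) by (auto simp: Y_def scalar_prod_def mv_def adj_def lessThan_atLeast0 intro!: sum.cong)
    then show ?thesis using w that nm by simp
  qed
  then show ?thesis using c by (intro exI[of _ "\<lambda>i. c * w $ i"]) (simp add: mv_scale)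
qed

text \<open>Take a unit eigenvector \<open>v\<close> of \<open>X\<^sup>\<dagger> X\<close>. Its
  eigenvalue is the squared norm of \<open>X v\<close>, hence has a real root \<open>s\<close>, and
  \<open>u\<close> is \<open>X v\<close> divided by \<open>s\<close>; the case \<open>s = 0\<close>
  is treated apart.\<close>

lemma exists_singular_pair:
  assumes n: "0 < n" and nm: "n \<le> m"
  shows "\<exists>v u s. ip n v v = 1 \<and> ip m u u = 1 \<and> (s :: real) \<ge> 0 \<and>
    (\<forall>i<m. mv n X v i = of_real s * u i) \<and> (\<forall>j<n. mv m (adj X) u j = of_real s * v j)"
proof -
  define T where "T i j = (\<Sum>k<m. adj X i k * X k j)" for i j
  have T: "mv n T v i = mv m (adj X) (mv n X v) i" for v i
  proof -
    have "mv n T v i = (\<Sum>j<n. \<Sum>k<m. adj X i k * (X k j * v j))"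
      by (simp add: mv_def T_def sum_distrib_right mult.assoc)
    also have "\<dots> = mv m (adj X) (mv n X v) i"
      unfolding mv_def sum_distrib_left by (rule sum.swap)
    finally show ?thesis .
  qed
  obtain v l where v: "ip n v v = 1" "\<And>i. i < n \<Longrightarrow> mv n T v i = l * v i"
    using exists_unit_eigenvector[OF n, of T] by blast
  have "ip m (mv n X v) (mv n X v) = ip n (mv n T v) v"
    using mv_adjoint[of n m "adj X" "mv n X v" v] by (simp add: T[abs_def])
  also have "\<dots> = ip n (\<lambda>i. l * v i) v" by (intro ip_cong) (simp_all add: v)
  finally have l: "ip m (mv n X v) (mv n X v) = l" by (simp add: ip_scale_left v)
  show ?thesis
  proof (cases "l = 0")
    case True
    then have "mv n X v i = 0" if "i < m" for i using l ip_self_eq_0[of m "mv n X v"] that by auto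
    moreover from this obtain u where "ip m u u = 1" "\<forall>j<n. mv m (adj X) u j = 0"
      using exists_unit_left_null[OF nm v(1), of X] by blast
    ultimately show ?thesis using v(1)
      by (intro exI[of _ v] exI[of _ u] exI[of _ "0 :: real"]) simp
  next
    case False
    define s where "s = sqrt (\<Sum>i<m. (cmod (mv n X v i))\<^sup>2)"
    have s0: "s \<ge> 0" by (simp add: s_def sum_nonneg)
    have ss: "complex_of_real s * complex_of_real s = l"
      unfolding l[symmetric] ip_self s_def of_real_mult[symmetric] by (simp add: sum_nonneg)
    then have s: "complex_of_real s \<noteq> 0" using False by auto
    define u where "u i = inverse (of_real s) * mv n X v i" for i
    have "ip m u u = inverse (of_real s) * (inverse (of_real s) * l)"
      unfolding u_def[abs_def] by (simp add: ip_scale_left ip_scale_right l)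
    then have "ip m u u = 1" using s unfolding ss[symmetric] by (simp add: field_simps)
    moreover have "mv n X v i = of_real s * u i" for i using s by (simp add: u_def)
    moreover have "mv m (adj X) u j = of_real s * v j" if "j < n" for j
      unfolding u_def[abs_def] mv_scale T[symmetric] v(2)[OF that] using s by (simp flip: ss)
    ultimately show ?thesis using v(1) s0 by blast
  qed
qed

text \<open>Deflation: since the adjoint sends \<open>q 0\<close> to a multiple of
  \<open>p 0\<close>, \<open>Y\<close> maps the complement of \<open>p 0\<close> into that of
  \<open>q 0\<close>. There it is fully described by its compressed block, so relations for the
  block lift to \<open>Y\<close>.\<close>

lemma mv_compress:
  assumes p: "onb (Suc s) p" and q: "onb (Suc r) q"
    and q0: "\<And>j. j < Suc s \<Longrightarrow> mv (Suc r) (adj Y) (q 0) j = t * p 0 j"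
    and ab: "\<And>l. l < r \<Longrightarrow> mv s (\<lambda>i j. ip (Suc r) (mv (Suc s) Y (p (Suc j))) (q (Suc i))) a l = b l"
    and i: "i < Suc r"
  shows "mv (Suc s) Y (\<lambda>x. \<Sum>j<s. a j * p (Suc j) x) i = (\<Sum>l<r. b l * q (Suc l) i)"
proof -
  let ?w = "\<lambda>x. \<Sum>j<s. a j * p (Suc j) x"
  have mvw: "mv (Suc s) Y ?w = (\<lambda>x. \<Sum>j<s. a j * mv (Suc s) Y (p (Suc j)) x)"
    unfolding mv_def sum_distrib_left
    by (rule ext, subst sum.swap) (simp only: mult.left_commute)
  have "ip (Suc r) (mv (Suc s) Y ?w) (q 0) = ip (Suc s) ?w (mv (Suc r) (adj Y) (q 0))"
    by (rule mv_adjoint)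
  also have "\<dots> = ip (Suc s) ?w (\<lambda>j. t * p 0 j)" by (intro ip_cong) (simp_all add: q0)
  also have "\<dots> = 0" using p by (simp add: ip_scale_right ip_sum_left ip_scale_left onb_def)
  finally have 0: "ip (Suc r) (mv (Suc s) Y ?w) (q 0) = 0" .
  have "ip (Suc r) (mv (Suc s) Y ?w) (q (Suc l)) = b l" if "l < r" for l
    unfolding mvw ip_sum_left ip_scale_left ab[OF that, symmetric] by (simp only: mv_def[of s] mult.commute)
  then have "(\<Sum>k<Suc r. ip (Suc r) (mv (Suc s) Y ?w) (q k) * q k i) = (\<Sum>l<r. b l * q (Suc l) i)"
    unfolding sum.lessThan_Suc_shift by (simp add: 0)
  then show ?thesis using onb_expand[OF q i, of "mv (Suc s) Y ?w"] by simp
qed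

lemma onb_lift:
  assumes p: "onb (Suc s) p" and a: "onb s a"
  shows "onb (Suc s) (case_nat (p 0) (\<lambda>k x. \<Sum>j<s. a k j * p (Suc j) x))"
proof -
  have "ip (Suc s) (\<lambda>x. \<Sum>j<s. a k j * p (Suc j) x) (\<lambda>x. \<Sum>j<s. a l j * p (Suc j) x) = of_bool (k = l)"
    if "k < s" "l < s" for k l
  proof -
    have "ip (Suc s) (\<lambda>x. \<Sum>j<s. a k j * p (Suc j) x) (\<lambda>x. \<Sum>j<s. a l j * p (Suc j) x)
       = (\<Sum>i<s. \<Sum>j<s. a k i * (cnj (a l j) * ip (Suc s) (p (Suc i)) (p (Suc j))))"
      by (simp add: ip_sum_left ip_sum_right ip_scale_left ip_scale_right sum_distrib_left)
    also have "\<dots> = (\<Sum>i<s. \<Sum>j<s. if i = j then a k i * cnj (a l j) else 0)"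
      using p by (intro sum.cong) (auto simp: onb_def)
    also have "\<dots> = ip s (a k) (a l)" by (simp add: ip_def)
    finally show ?thesis using a that by (simp add: onb_def)
  qed
  moreover have "ip (Suc s) (p 0) (\<lambda>x. \<Sum>j<s. a k j * p (Suc j) x) = 0"
    "ip (Suc s) (\<lambda>x. \<Sum>j<s. a k j * p (Suc j) x) (p 0) = 0" for k
    using p by (simp_all add: ip_sum_left ip_sum_right ip_scale_left ip_scale_right onb_def)
  moreover have "ip (Suc s) (p 0) (p 0) = 1" using p by (simp add: onb_def)
  ultimately show ?thesis unfolding onb_def by (auto split: nat.splits)
qed

text \<open>Induction on the smaller dimension: one singular pair is split off and the rest is
  compressed to the orthogonal complements. The zero branch of the last clause records that the
  surplus vectors \<open>u k\<close> are left null vectors; they become the zero modes.\<close>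

theorem singular_value_decomposition:
  assumes "n \<le> m"
  shows "\<exists>u v (s :: nat \<Rightarrow> real). onb m u \<and> onb n v \<and> (\<forall>k<n. s k \<ge> 0) \<and>
    (\<forall>k<n. \<forall>i<m. mv n X (v k) i = of_real (s k) * u k i) \<and>
    (\<forall>k<m. \<forall>j<n. mv m (adj X) (u k) j = (if k < n then of_real (s k) * v k j else 0))"
  using assms
proof (induction n arbitrary: m X)
  case 0
  have "ip m (\<lambda>i. of_bool (i = k)) (\<lambda>i. of_bool (i = l)) = of_bool (k = l)" if "k < m" for k l :: nat
  proof -
    have "ip m (\<lambda>i. of_bool (i = k)) (\<lambda>i. of_bool (i = l)) = (\<Sum>i<m. if i = k then of_bool (k = l) else 0)"
      unfolding ip_def by (intro sum.cong) auto
    then show ?thesis using that by simp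
  qed
  then have "onb m (\<lambda>k i. of_bool (i = k))" by (simp add: onb_def)
  moreover have "onb 0 (\<lambda>_ _. 0)" by (simp add: onb_def)
  ultimately show ?case
    by (intro exI[of _ "\<lambda>k i. of_bool (i = k)"] exI[of _ "\<lambda>_ _. 0"] exI[of _ "\<lambda>_. 0"]) auto
next
  case (Suc n m X)
  then obtain m' where m: "m = Suc m'" and nm: "n \<le> m'" by (cases m) auto
  obtain v0 u0 s0 where 0: "ip (Suc n) v0 v0 = 1" "ip m u0 u0 = 1" "(s0 :: real) \<ge> 0"
    "\<And>i. i < m \<Longrightarrow> mv (Suc n) X v0 i = of_real s0 * u0 i"
    "\<And>j. j < Suc n \<Longrightarrow> mv m (adj X) u0 j = of_real s0 * v0 j"
    using exists_singular_pair[of "Suc n" m X] Suc.prems by auto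
  obtain p where p: "onb (Suc n) p" "p 0 = v0" using onb_extend[OF 0(1)] by blast
  obtain q where q: "onb (Suc m') q" "q 0 = u0" using onb_extend[OF 0(2)[unfolded m]] by blast
  \<comment> \<open>The block of X between the complements of \<open>v0\<close> and
    \<open>u0\<close>, in the completed bases.\<close>
  define X' where "X' i j = ip (Suc m') (mv (Suc n) X (p (Suc j))) (q (Suc i))" for i j
  \<comment> \<open>The adjoint of the compression is the compression of the adjoint, so
    \<open>mv_compress\<close> can be applied to both directions.\<close>
  have adjX': "adj X' = (\<lambda>i j. ip (Suc n) (mv (Suc m') (adj X) (q (Suc j))) (p (Suc i)))"
    unfolding X'_def adj_def cnj_ip using mv_adjoint[of "Suc n" "Suc m'" "adj X"] by (simp add: fun_eq_iff adj_def[abs_def])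
  obtain u v and s :: "nat \<Rightarrow> real" where IH: "onb m' u" "onb n v" "\<And>k. k < n \<Longrightarrow> s k \<ge> 0"
    "\<And>k i. k < n \<Longrightarrow> i < m' \<Longrightarrow> mv n X' (v k) i = of_real (s k) * u k i"
    "\<And>k j. k < m' \<Longrightarrow> j < n \<Longrightarrow> mv m' (adj X') (u k) j = (if k < n then of_real (s k) * v k j else 0)"
    using Suc.IH[OF nm, of X'] by blast
  define U where "U = case_nat (q 0) (\<lambda>k x. \<Sum>j<m'. u k j * q (Suc j) x)"
  define V where "V = case_nat (p 0) (\<lambda>k x. \<Sum>j<n. v k j * p (Suc j) x)"
  define S where "S = case_nat s0 s"
  have 1: "mv (Suc n) X (V k) i = of_real (S k) * U k i" if k: "k < Suc n" and i: "i < m" for k i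
  proof (cases k)
    case 0
    then show ?thesis using \<open>\<And>i. i < m \<Longrightarrow> mv (Suc n) X v0 i = of_real s0 * u0 i\<close>[OF i] by (simp add: V_def U_def S_def p q)
  next
    case (Suc k')
    then have "mv (Suc n) X (V k) i = (\<Sum>l<m'. (of_real (s k') * u k' l) * q (Suc l) i)"
      unfolding V_def Suc nat.case
      by (intro mv_compress[OF p(1) q(1), where t = "of_real s0"])
        (use 0 k i Suc IH(4)[of k', unfolded X'_def[abs_def]] in \<open>auto simp: m p q\<close>)
    then show ?thesis by (simp add: U_def S_def Suc sum_distrib_left mult.assoc)
  qed
  have 2: "mv m (adj X) (U k) j = (if k < Suc n then of_real (S k) * V k j else 0)" if k: "k < m" and j: "j < Suc n" for k j
  proof (cases k)
    case 0
    then show ?thesis using \<open>\<And>j. j < Suc n \<Longrightarrow> mv m (adj X) u0 j = of_real s0 * v0 j\<close>[OF j] by (simp add: V_def U_def S_def p q)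
  next
    case (Suc k')
    then have "mv m (adj X) (U k) j = (\<Sum>l<n. (if k' < n then of_real (s k') * v k' l else 0) * p (Suc l) j)"
      unfolding U_def Suc nat.case m
      by (intro mv_compress[OF q(1) p(1), where t = "of_real s0"])
        (use 0 k j Suc IH(5)[of k', unfolded adjX'] in \<open>auto simp: m p q\<close>)
    then show ?thesis by (simp add: V_def S_def Suc sum_distrib_left mult.assoc)
  qed
  have "onb m U" unfolding U_def m by (rule onb_lift[OF q(1) IH(1)])
  moreover have "onb (Suc n) V" unfolding V_def by (rule onb_lift[OF p(1) IH(2)])
  moreover have "S k \<ge> 0" if "k < Suc n" for k using that 0 IH(3) by (auto simp: S_def split: nat.splits)
  ultimately show ?case using 1 2 by (intro exI[of _ U] exI[of _ V] exI[of _ S]) auto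
qed

section \<open>Separating the modes in $A$ from those in $B$\<close>

lemma bit_sum_two_powers:
  assumes "finite I"
  shows "bit (\<Sum>i\<in>I. 2 ^ i :: nat) j \<longleftrightarrow> j \<in> I"
  using assms
proof (induction I arbitrary: j rule: finite_induct)
  case (insert i I)
  then have "\<not> bit (\<Sum>i\<in>I. 2 ^ i :: nat) i" by simp
  then have "(\<Sum>i\<in>insert i I. 2 ^ i :: nat) = set_bit i (\<Sum>i\<in>I. 2 ^ i)"
    using insert by (simp add: set_bit_eq)
  then show ?case using insert by (auto simp: bit_set_bit_iff)
qed simp

lemma nat_less_two_power_iff: "(x :: nat) < 2 ^ n \<longleftrightarrow> (\<forall>i\<ge>n. \<not> bit x i)"
proof
  assume "x < 2 ^ n"
  then have "take_bit n x = x" by (simp add: take_bit_nat_eq_self)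
  then show "\<forall>i\<ge>n. \<not> bit x i" by (metis bit_take_bit_iff not_le)
next
  assume *: "\<forall>i\<ge>n. \<not> bit x i"
  then have "bit x i \<Longrightarrow> i < n" for i by (meson leI)
  then have "take_bit n x = x" by (intro bit_eqI) (auto simp: bit_take_bit_iff)
  then show "x < 2 ^ n" by (metis take_bit_nat_less_exp)
qed

locale bipartition =
  fixes N :: nat and A B :: "nat set"
  assumes un: "A \<union> B = {..<N}" and disj: "A \<inter> B = {}"
begin

abbreviation "sA \<equiv> sorted_list_of_set A"
abbreviation "sB \<equiv> sorted_list_of_set B"
abbreviation "a \<equiv> card A"
abbreviation "b \<equiv> card B"

lemma fin: "finite A" "finite B"
  using un by (metis finite_Un finite_lessThan)+

lemma sA: "bij_betw (nth sA) {..<a} A" and sB: "bij_betw (nth sB) {..<b} B"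
  using fin by (auto intro!: bij_betw_nth)

lemma sA_in: "k < a \<Longrightarrow> sA ! k \<in> A" and sB_in: "k < b \<Longrightarrow> sB ! k \<in> B"
  using sA sB by (auto simp: bij_betw_def)

lemma sA_less_N: "k < a \<Longrightarrow> sA ! k < N" and sB_less_N: "k < b \<Longrightarrow> sB ! k < N"
  using sA_in sB_in un by auto

lemma sA_eq_iff: "k < a \<Longrightarrow> l < a \<Longrightarrow> sA ! k = sA ! l \<longleftrightarrow> k = l"
  and sB_eq_iff: "k < b \<Longrightarrow> l < b \<Longrightarrow> sB ! k = sB ! l \<longleftrightarrow> k = l"
  by (simp_all add: nth_eq_iff_index_eq)

lemma sA_neq_sB: "k < a \<Longrightarrow> l < b \<Longrightarrow> sA ! k \<noteq> sB ! l"
  using sA_in[of k] sB_in[of l] disj by auto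

lemma sA_less_iff: "k < a \<Longrightarrow> l < a \<Longrightarrow> sA ! k < sA ! l \<longleftrightarrow> k < l"
  and sB_less_iff: "k < b \<Longrightarrow> l < b \<Longrightarrow> sB ! k < sB ! l \<longleftrightarrow> k < l"
proof -
  have mono: "sorted_list_of_set X ! i < sorted_list_of_set X ! j" if "i < j" "j < card X" for i j :: nat and X :: "nat set"
    using sorted_wrt_nth_less[OF sorted_list_of_set.strict_sorted_key_list_of_set, of i j X] that by simp
  show "k < a \<Longrightarrow> l < a \<Longrightarrow> sA ! k < sA ! l \<longleftrightarrow> k < l"
    using mono[of k l A] mono[of l k A] by (cases k l rule: linorder_cases) auto
  show "k < b \<Longrightarrow> l < b \<Longrightarrow> sB ! k < sB ! l \<longleftrightarrow> k < l"
    using mono[of k l B] mono[of l k B] by (cases k l rule: linorder_cases) auto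
qed

lemma sum_split: "(\<Sum>i<N. f i) = (\<Sum>k<b. f (sB ! k)) + (\<Sum>k<a. f (sA ! k))" for f :: "nat \<Rightarrow> 'c :: comm_monoid_add"
proof -
  have "(\<Sum>i<N. f i) = sum f B + sum f A"
    unfolding un[symmetric] using fin disj by (subst sum.union_disjoint) (auto simp: add.commute)
  then show ?thesis by (simp add: sum.reindex_bij_betw[OF sA] sum.reindex_bij_betw[OF sB])
qed

lemma bit_join_idx:
  "bit (join_idx A B y z) i \<longleftrightarrow> (\<exists>k<b. i = sB ! k \<and> bit y k) \<or> (\<exists>k<a. i = sA ! k \<and> bit z k)"
proof -
  let ?IB = "(nth sB) ` {k. k < b \<and> bit y k}" and ?IA = "(nth sA) ` {k. k < a \<and> bit z k}"
  have IB: "inj_on (nth sB) {k. k < b \<and> bit y k}" by (rule inj_onI) (simp add: sB_eq_iff)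
  have IA: "inj_on (nth sA) {k. k < a \<and> bit z k}" by (rule inj_onI) (simp add: sA_eq_iff)
  have "(\<Sum>k<b. if bit y k then 2 ^ (sB ! k) else 0) = (\<Sum>k | k < b \<and> bit y k. 2 ^ (sB ! k) :: nat)"
    by (intro sum.mono_neutral_cong_right) auto
  then have 1: "(\<Sum>k<b. if bit y k then 2 ^ (sB ! k) else 0) = (\<Sum>i\<in>?IB. 2 ^ i :: nat)"
    by (simp add: sum.reindex[OF IB])
  have "(\<Sum>k<a. if bit z k then 2 ^ (sA ! k) else 0) = (\<Sum>k | k < a \<and> bit z k. 2 ^ (sA ! k) :: nat)"
    by (intro sum.mono_neutral_cong_right) auto
  then have 2: "(\<Sum>k<a. if bit z k then 2 ^ (sA ! k) else 0) = (\<Sum>i\<in>?IA. 2 ^ i :: nat)"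
    by (simp add: sum.reindex[OF IA])
  have "?IB \<inter> ?IA = {}" by (auto simp: sA_neq_sB[symmetric])
  then have "join_idx A B y z = (\<Sum>i\<in>?IB \<union> ?IA. 2 ^ i)"
    unfolding join_idx_def 1 2 by (subst sum.union_disjoint) auto
  then have "bit (join_idx A B y z) i \<longleftrightarrow> i \<in> ?IB \<union> ?IA"
    using bit_sum_two_powers[of "?IB \<union> ?IA" i] by simp
  then show ?thesis by auto
qed

lemma bit_join_B: "k < b \<Longrightarrow> bit (join_idx A B y z) (sB ! k) \<longleftrightarrow> bit y k"
  unfolding bit_join_idx using sA_neq_sB by (metis sB_eq_iff)

lemma bit_join_A: "k < a \<Longrightarrow> bit (join_idx A B y z) (sA ! k) \<longleftrightarrow> bit z k"
  unfolding bit_join_idx using sA_neq_sB by (metis sA_eq_iff)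

lemma join_less: "join_idx A B y z < 2 ^ N"
  unfolding nat_less_two_power_iff bit_join_idx using sA_less_N sB_less_N by (metis not_le)

lemma join_flip_B: "k < b \<Longrightarrow> join_idx A B (flip_bit k y) z = flip_bit (sB ! k) (join_idx A B y z)"
  by (intro bit_eqI) (auto simp: bit_join_idx sB_eq_iff sA_neq_sB sA_neq_sB[symmetric])

lemma join_flip_A: "k < a \<Longrightarrow> join_idx A B y (flip_bit k z) = flip_bit (sA ! k) (join_idx A B y z)"
  by (intro bit_eqI) (auto simp: bit_join_idx sA_eq_iff sA_neq_sB sA_neq_sB[symmetric])

lemma join_eq_0_iff: "join_idx A B y z = 0 \<longleftrightarrow> (\<forall>k<b. \<not> bit y k) \<and> (\<forall>k<a. \<not> bit z k)"
proof -
  have "join_idx A B y z = 0 \<longleftrightarrow> (\<forall>i. \<not> bit (join_idx A B y z) i)"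
    by (auto intro: bit_eqI)
  then show ?thesis unfolding bit_join_idx by auto
qed

lemma reorder_sign_prod:
  "reorder_sign A B x = (\<Prod>i\<in>A. \<Prod>j\<in>B. if i < j \<and> bit x i \<and> bit x j then -1 else 1)"
proof -
  have "(\<Prod>i\<in>A. \<Prod>j\<in>B. if i < j \<and> bit x i \<and> bit x j then -1 else 1 :: complex)
      = (\<Prod>p\<in>A \<times> B. if fst p < snd p \<and> bit x (fst p) \<and> bit x (snd p) then -1 else 1)"
    by (simp add: prod.cartesian_product split_beta)
  also have "\<dots> = (-1) ^ card ((A \<times> B) \<inter> {p. fst p < snd p \<and> bit x (fst p) \<and> bit x (snd p)})"
    using fin by (subst prod.If_cases) (auto simp: prod_constant)
  also have "(A \<times> B) \<inter> {p. fst p < snd p \<and> bit x (fst p) \<and> bit x (snd p)}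
     = {(i, j). i \<in> A \<and> j \<in> B \<and> i < j \<and> bit x i \<and> bit x j}" by auto
  finally show ?thesis by (simp add: reorder_sign_def)
qed

lemma jw_sign_split:
  assumes "j < N"
  shows "jw_sign x j = (\<Prod>i\<in>A. if i < j \<and> bit x i then -1 else 1) * (\<Prod>i\<in>B. if i < j \<and> bit x i then -1 else 1)"
proof -
  have "jw_sign x j = (\<Prod>i<N. if i < j \<and> bit x i then -1 else 1)"
    unfolding jw_sign_prod using assms by (intro prod.mono_neutral_cong_left) auto
  also have "\<dots> = (\<Prod>i\<in>A. if i < j \<and> bit x i then -1 else 1) * (\<Prod>i\<in>B. if i < j \<and> bit x i then -1 else 1)"
    unfolding un[symmetric] using fin disj by (subst prod.union_disjoint) auto
  finally show ?thesis .
qed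

text \<open>Only pairs that contain \<open>j\<close> change. Their product is the A-part of the
  Jordan-Wigner string of \<open>j\<close>, which thus cancels and leaves the string inside
  B.\<close>

lemma reorder_sign_flip_B:
  assumes "j \<in> B"
  shows "reorder_sign A B (flip_bit j x) = reorder_sign A B x * (\<Prod>i\<in>A. if i < j \<and> bit x i then -1 else 1)"
proof -
  have "(\<Prod>l\<in>B. if i < l \<and> bit (flip_bit j x) i \<and> bit (flip_bit j x) l then -1 else 1 :: complex)
      = (\<Prod>l\<in>B. if i < l \<and> bit x i \<and> bit x l then -1 else 1) * (if i < j \<and> bit x i then -1 else 1)"
    if "i \<in> A" for i
  proof -
    have ij: "i \<noteq> j" using that assms disj by auto
    have "(\<Prod>l\<in>B. if i < l \<and> bit (flip_bit j x) i \<and> bit (flip_bit j x) l then -1 else 1 :: complex)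
      = (\<Prod>l\<in>B. (if i < l \<and> bit x i \<and> bit x l then -1 else 1) * (if l = j then (if i < j \<and> bit x i then -1 else 1) else 1))"
      using ij by (intro prod.cong) auto
    then show ?thesis using fin assms by (simp add: prod.distrib)
  qed
  then show ?thesis unfolding reorder_sign_prod by (simp add: prod.distrib)
qed

text \<open>Here the affected pairs involve the B-modes above \<open>j\<close>. Together with the
  B-modes below \<open>j\<close> in the Jordan-Wigner string they give the parity of all of
  B.\<close>

lemma reorder_sign_flip_A:
  assumes "j \<in> A"
  shows "reorder_sign A B (flip_bit j x) = reorder_sign A B x * (\<Prod>l\<in>B. if j < l \<and> bit x l then -1 else 1)"
proof -
  have "(\<Prod>i\<in>A. if i < l \<and> bit (flip_bit j x) i \<and> bit (flip_bit j x) l then -1 else 1 :: complex)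
      = (\<Prod>i\<in>A. if i < l \<and> bit x i \<and> bit x l then -1 else 1) * (if j < l \<and> bit x l then -1 else 1)"
    if "l \<in> B" for l
  proof -
    have ij: "l \<noteq> j" using that assms disj by auto
    have "(\<Prod>i\<in>A. if i < l \<and> bit (flip_bit j x) i \<and> bit (flip_bit j x) l then -1 else 1 :: complex)
      = (\<Prod>i\<in>A. (if i < l \<and> bit x i \<and> bit x l then -1 else 1) * (if i = j then (if j < l \<and> bit x l then -1 else 1) else 1))"
      using ij by (intro prod.cong) auto
    then show ?thesis using fin assms by (simp add: prod.distrib)
  qed
  then show ?thesis unfolding reorder_sign_prod by (subst (1 2) prod.swap) (simp add: prod.distrib)
qed

text \<open>Amplitudes in the ordering with B first: row \<open>y\<close> is the occupation of B,
  column \<open>z\<close> that of A.\<close>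

definition bipartite :: "(nat \<Rightarrow> complex) \<Rightarrow> amp" where
  "bipartite \<phi> y z = reorder_sign A B (join_idx A B y z) * \<phi> (join_idx A B y z)"

lemma bipartite_fop_B:
  assumes k: "k < b"
  shows "bipartite (fop t (sB ! k) \<phi>) y z = fop t k (\<lambda>y. bipartite \<phi> y z) y"
proof -
  let ?x = "join_idx A B y z" and ?j = "sB ! k"
  have "(\<Prod>i\<in>B. if i < ?j \<and> bit ?x i then -1 else 1 :: complex) = (\<Prod>l<b. if sB ! l < ?j \<and> bit ?x (sB ! l) then -1 else 1)"
    by (rule prod.reindex_bij_betw[OF sB, symmetric])
  also have "\<dots> = (\<Prod>l<b. if l < k \<and> bit y l then -1 else 1)"
    using k by (intro prod.cong) (auto simp: bit_join_B sB_less_iff)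
  also have "\<dots> = jw_sign y k"
    unfolding jw_sign_prod using k by (intro prod.mono_neutral_cong_right) auto
  finally have "jw_sign ?x ?j = (\<Prod>i\<in>A. if i < ?j \<and> bit ?x i then -1 else 1) * jw_sign y k"
    unfolding jw_sign_split[OF sB_less_N[OF k]] by simp
  then have "reorder_sign A B ?x * jw_sign ?x ?j = jw_sign y k * reorder_sign A B (flip_bit ?j ?x)"
    unfolding reorder_sign_flip_B[OF sB_in[OF k]] by simp
  then show ?thesis
    unfolding bipartite_def fop_def join_flip_B[OF k] bit_join_B[OF k] by (auto simp: mult.assoc[symmetric])
qed

lemma bipartite_fop_A:
  assumes k: "k < a"
  shows "bipartite (fop t (sA ! k) \<phi>) y z = jw_sign y b * fop t k (bipartite \<phi> y) z"
proof -
  let ?x = "join_idx A B y z" and ?j = "sA ! k"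
  have "(\<Prod>i\<in>A. if i < ?j \<and> bit ?x i then -1 else 1 :: complex) = (\<Prod>l<a. if sA ! l < ?j \<and> bit ?x (sA ! l) then -1 else 1)"
    by (rule prod.reindex_bij_betw[OF sA, symmetric])
  also have "\<dots> = (\<Prod>l<a. if l < k \<and> bit z l then -1 else 1)"
    using k by (intro prod.cong) (auto simp: bit_join_A sA_less_iff)
  also have "\<dots> = jw_sign z k"
    unfolding jw_sign_prod using k by (intro prod.mono_neutral_cong_right) auto
  finally have 1: "jw_sign ?x ?j = jw_sign z k * (\<Prod>i\<in>B. if i < ?j \<and> bit ?x i then -1 else 1)"
    unfolding jw_sign_split[OF sA_less_N[OF k]] by simp
  let ?lo = "\<Prod>i\<in>B. if i < ?j \<and> bit ?x i then -1 else 1 :: complex"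
  let ?hi = "\<Prod>i\<in>B. if ?j < i \<and> bit ?x i then -1 else 1 :: complex"
  have "jw_sign y b = (\<Prod>l<b. if bit ?x (sB ! l) then -1 else 1)"
    unfolding jw_sign_prod by (intro prod.cong) (auto simp: bit_join_B)
  also have "\<dots> = (\<Prod>i\<in>B. if bit ?x i then -1 else 1)"
    by (rule prod.reindex_bij_betw[OF sB])
  also have "\<dots> = ?lo * ?hi"
    unfolding prod.distrib[symmetric] using sA_in[OF k] disj by (intro prod.cong) (auto simp: not_less_iff_gr_or_eq)
  finally have par: "jw_sign y b = ?lo * ?hi" .
  have "?hi * ?hi = 1"
    unfolding prod.distrib[symmetric] by (intro prod.neutral) auto
  \<comment> \<open>The string contributes the B-modes below \<open>j\<close> and the reordering
    those above. As signs square to 1, trading one for the other costs exactly the total parity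
    \<open>jw_sign y b\<close>.\<close>
  then have lo: "?lo = jw_sign y b * ?hi" unfolding par by (simp add: mult.assoc)
  have "reorder_sign A B ?x * jw_sign ?x ?j = jw_sign y b * (jw_sign z k * reorder_sign A B (flip_bit ?j ?x))"
    unfolding reorder_sign_flip_A[OF sA_in[OF k]] 1 lo by (simp only: mult.assoc mult.commute mult.left_commute)
  then have "reorder_sign A B ?x * (jw_sign ?x ?j * c) = jw_sign y b * (jw_sign z k * (reorder_sign A B (flip_bit ?j ?x) * c))" for c
    by (simp only: mult.assoc[symmetric])
  then show ?thesis
    unfolding bipartite_def fop_def join_flip_A[OF k] bit_join_A[OF k] by auto
qed

lemma bipartite_lop:
  "bipartite (lop N p q \<phi>) = (\<lambda>y z. lopL b (\<lambda>k. p (sB ! k)) (\<lambda>k. q (sB ! k)) (bipartite \<phi>) y z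
     + par b (lopR a (\<lambda>k. p (sA ! k)) (\<lambda>k. q (sA ! k)) (bipartite \<phi>)) y z)"
proof (intro ext)
  fix y z
  have lin: "reorder_sign A B x * lop N p q \<phi> x
     = (\<Sum>i<N. p i * (reorder_sign A B x * fop False i \<phi> x) + q i * (reorder_sign A B x * fop True i \<phi> x))" for x
    by (simp add: lop_def sum_distrib_left algebra_simps)
  have "bipartite (lop N p q \<phi>) y z = (\<Sum>i<N. p i * bipartite (fop False i \<phi>) y z + q i * bipartite (fop True i \<phi>) y z)"
    unfolding bipartite_def lin ..
  also have "\<dots> = lopL b (\<lambda>k. p (sB ! k)) (\<lambda>k. q (sB ! k)) (bipartite \<phi>) y z
     + par b (lopR a (\<lambda>k. p (sA ! k)) (\<lambda>k. q (sA ! k)) (bipartite \<phi>)) y z"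
    unfolding sum_split lopL_def lopR_def par_def lop_def
    by (simp add: bipartite_fop_A bipartite_fop_B sum_distrib_left algebra_simps)
  finally show "bipartite (lop N p q \<phi>) y z = lopL b (\<lambda>k. p (sB ! k)) (\<lambda>k. q (sB ! k)) (bipartite \<phi>) y z
     + par b (lopR a (\<lambda>k. p (sA ! k)) (\<lambda>k. q (sA ! k)) (bipartite \<phi>)) y z" .
qed

lemma ent_inv_vac: "ent_inv b a 1 UNIV UNIV (bipartite vac)"
proof -
  \<comment> \<open>Not the test \<open>y = 0\<close>: \<open>join_idx\<close> ignores bits from
    position \<open>n\<close> on, and the invariant is an equality of functions on all of
    \<open>nat\<close>. Below \<open>2 ^ n\<close> both tests agree.\<close>
  define P where "P n (y :: nat) = (of_bool (\<forall>k<n. \<not> bit y k) :: complex)" for n y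
  have rs0: "reorder_sign A B 0 = 1" by (simp add: reorder_sign_prod)
  have K: "bipartite vac = (\<lambda>y z. P b y * P a z)"
  proof (intro ext)
    fix y z
    have "bipartite vac y z = of_bool (join_idx A B y z = 0)"
      unfolding bipartite_def vac_def by (cases "join_idx A B y z = 0") (simp_all add: rs0)
    then show "bipartite vac y z = P b y * P a z"
      unfolding join_eq_0_iff P_def by simp
  qed
  have P_less: "P n y = of_bool (y = 0)" if "y < 2 ^ n" for n y
  proof -
    have "(\<forall>k<n. \<not> bit y k) \<longleftrightarrow> y = 0"
    proof
      assume *: "\<forall>k<n. \<not> bit y k"
      show "y = 0"
        by (rule bit_eqI) (use * that in \<open>auto simp: nat_less_two_power_iff dest: leI\<close>)
    qed simp
    then show ?thesis by (simp add: P_def)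
  qed
  have P0: "P n 0 = 1" for n by (simp add: P_def)
  have delta: "(\<Sum>y<2 ^ n. P n y * f y) = f 0" for n and f :: "nat \<Rightarrow> complex"
  proof -
    have "(\<Sum>y<2 ^ n. P n y * f y) = (\<Sum>y<2 ^ n. if y = (0 :: nat) then f y else 0)"
      by (intro sum.cong) (auto simp: P_less)
    then show ?thesis by simp
  qed
  have cnjP: "cnj (P n y) = P n y" for n y by (simp add: P_def)
  have "tri b a (bipartite vac) (bipartite vac) (bipartite vac) y z = 1 * bipartite vac y z" for y z
  proof -
    have "tri b a (bipartite vac) (bipartite vac) (bipartite vac) y z
        = (\<Sum>y'<2 ^ b. P b y' * (P b y' * (\<Sum>z'<2 ^ a. P a z' * (P a z' * (P b y * P a z)))))"
      unfolding tri_def K by (simp add: cnjP sum_distrib_left algebra_simps)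
    then show ?thesis by (simp only: delta P0 K) simp
  qed
  moreover have "hs b a (bipartite vac) (bipartite vac) = 1"
  proof -
    have "hs b a (bipartite vac) (bipartite vac)
        = (\<Sum>y'<2 ^ b. P b y' * (P b y' * (\<Sum>z'<2 ^ a. P a z' * P a z')))"
      unfolding hs_def ip_def K by (simp add: cnjP sum_distrib_left algebra_simps)
    then show ?thesis by (simp only: delta P0) simp
  qed
  moreover have ann: "lop n p (\<lambda>_. 0) (P n) = (\<lambda>_. 0)" for n p
  proof -
    have "fop False i (P n) x = 0" if "i < n" for i x
      using that by (auto simp: fop_def P_def)
    then show ?thesis by (simp add: lop_def fun_eq_iff)
  qed
  have "aL b v (bipartite vac) = (\<lambda>_ _. 0)" for v
    unfolding K lopL_def using lop_scale[of b _ _ "P a _" "P b"] ann[of b] by (simp add: fun_eq_iff mult.commute)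
  moreover have "aR a u (bipartite vac) = (\<lambda>_ _. 0)" for u
    unfolding K lopR_apply[abs_def] using lop_scale[of a _ _ "P b _" "P a"] ann[of a] by (simp add: fun_eq_iff)
  ultimately show ?thesis unfolding ent_inv_def by (auto simp: fun_eq_iff)
qed

end

section \<open>Flat spectra\<close>

lemma order_prod_list_linear:
  fixes c :: "'a :: idom"
  shows "order c (\<Prod>a\<leftarrow>as. [:- a, 1:]) = count_list as c"
proof (induction as)
  case (Cons a as)
  have "(\<Prod>a\<leftarrow>a # as. [:- a, 1:]) \<noteq> 0" unfolding prod_list_zero_iff by auto
  moreover have "order c [:- a, 1:] = (if a = c then 1 else 0)"
    using order_power_n_n[of c 1] by (auto intro!: order_0I)
  ultimately show ?case using Cons.IH by (simp add: order_mult del: mult_pCons_left)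
qed (auto intro!: order_0I)

lemma trace_mult_commute:
  assumes "A \<in> carrier_mat n m" and "B \<in> carrier_mat m n"
  shows "(\<Sum>i<n. (A * B) $$ (i, i)) = (\<Sum>i<m. (B * A) $$ (i, i) :: 'a :: comm_ring_1)"
proof -
  have "(\<Sum>i<n. (A * B) $$ (i, i)) = (\<Sum>i<n. \<Sum>j<m. A $$ (i, j) * B $$ (j, i))"
    using assms by (auto simp: scalar_prod_def lessThan_atLeast0 intro!: sum.cong)
  also have "\<dots> = (\<Sum>j<m. \<Sum>i<n. A $$ (i, j) * B $$ (j, i))" by (rule sum.swap)
  also have "\<dots> = (\<Sum>i<m. (B * A) $$ (i, i))"
    using assms by (auto simp: scalar_prod_def lessThan_atLeast0 mult.commute intro!: sum.cong)
  finally show ?thesis .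
qed

text \<open>Schur decomposition puts the listed roots, with multiplicity, on the diagonal of a
  similar matrix; cyclicity of the trace removes the similarity.\<close>

lemma trace_eq_sum_roots:
  fixes A :: "complex mat"
  assumes A: "A \<in> carrier_mat n n" and as: "char_poly A = (\<Prod>a\<leftarrow>as. [:- a, 1:])"
  shows "(\<Sum>i<n. A $$ (i, i)) = sum_list as"
proof -
  obtain B P Q where B: "schur_decomposition A as = (B, P, Q)" by (cases "schur_decomposition A as")
  from schur_decomposition[OF A as B] have sim: "similar_mat_wit A B P Q" and diag: "diag_mat B = as" by auto
  note sim = similar_mat_witD2[OF A sim]
  have "(\<Sum>i<n. A $$ (i, i)) = (\<Sum>i<n. (P * (B * Q)) $$ (i, i))"
    using sim by (simp add: assoc_mult_mat[of P n n B n Q n])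
  also have "\<dots> = (\<Sum>i<n. ((B * Q) * P) $$ (i, i))"
    using sim by (intro trace_mult_commute) auto
  also have "(B * Q) * P = B" using sim by (simp add: assoc_mult_mat[of B n n Q n P n])
  also have "(\<Sum>i<n. B $$ (i, i)) = sum_list as"
    using sim unfolding diag[symmetric] diag_mat_def by (simp add: sum_list_sum_nth lessThan_atLeast0)
  finally show ?thesis .
qed

text \<open>The quadratic equation leaves only the eigenvalues 0 and \<open>1 / 2 ^ n\<close>, and
  unit trace gives the latter multiplicity \<open>2 ^ n\<close>. All entropies of such a spectrum
  coincide.\<close>

lemma renyi_entropy_flat:
  fixes \<rho> :: "complex mat"
  assumes \<rho>: "\<rho> \<in> carrier_mat d d" and sq: "\<rho> * \<rho> = complex_of_real (1 / 2 ^ n) \<cdot>\<^sub>m \<rho>"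
    and tr: "(\<Sum>i<d. \<rho> $$ (i, i)) = 1"
  shows "renyi_entropy \<alpha> \<rho> = real n"
proof -
  define c where "c = complex_of_real (1 / 2 ^ n)"
  have c0: "Re c > 0" "c \<noteq> 0" by (simp_all add: c_def)
  have Rec: "Re c = 1 / 2 ^ n" by (simp add: c_def)
  obtain as where as: "char_poly \<rho> = (\<Prod>a\<leftarrow>as. [:- a, 1:])" using char_poly_factorized[OF \<rho>] by blast
  have ev: "eigenvalue \<rho> l \<longleftrightarrow> l \<in> set as" for l
    unfolding eigenvalue_root_char_poly[OF \<rho>] as by (auto simp: poly_prod_list prod_list_zero_iff o_def)
  have ev_cases: "l = 0 \<or> l = c" if l: "l \<in> set as" for l
  proof -
    obtain v where v: "v \<in> carrier_vec d" "v \<noteq> 0\<^sub>v d" "\<rho> *\<^sub>v v = l \<cdot>\<^sub>v v"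
      using l \<rho> unfolding ev[symmetric] eigenvalue_def eigenvector_def by auto
    have "(\<rho> * \<rho>) *\<^sub>v v = l \<cdot>\<^sub>v (l \<cdot>\<^sub>v v)"
      using \<rho> v by (simp add: assoc_mult_mat_vec[OF \<rho> \<rho>] mult_mat_vec[OF \<rho> v(1)])
    moreover have "(\<rho> * \<rho>) *\<^sub>v v = c \<cdot>\<^sub>v (l \<cdot>\<^sub>v v)"
    proof -
      have "(c \<cdot>\<^sub>m \<rho>) *\<^sub>v v = c \<cdot>\<^sub>v (\<rho> *\<^sub>v v)"
        using \<rho> v(1) by (intro eq_vecI) (auto simp: scalar_prod_def sum_distrib_left mult.assoc)
      then show ?thesis by (simp add: sq c_def v)
    qed
    moreover obtain i where i: "i < d" "v $ i \<noteq> 0"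
      using v(1,2) by (metis carrier_vecD eq_vecI index_zero_vec(1) index_zero_vec(2))
    ultimately have "l * (l * v $ i) = c * (l * v $ i)"
      using v(1) by (metis index_smult_vec(1) index_smult_vec(2) carrier_vecD)
    then show ?thesis using i by auto
  qed
  \<comment> \<open>Roots equal to 0 add nothing, so the trace is the multiplicity of
    \<open>c\<close> times \<open>c\<close>.\<close>
  have "sum_list as = of_nat (count_list as c) * c"
    using ev_cases
  proof (induction as)
    case (Cons a as)
    then show ?case using c0 by (auto simp: algebra_simps)
  qed simp
  then have "of_nat (count_list as c) * c = 1" using trace_eq_sum_roots[OF \<rho> as] tr by simp
  then have "Re (of_nat (count_list as c) * c) = 1" by simp
  then have cnt: "real (count_list as c) = 2 ^ n" by (simp add: Rec)
  then have "count_list as c \<noteq> 0" by (metis of_nat_0 power_not_zero zero_neq_numeral)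
  then have "c \<in> set as" by (metis count_list_0_iff)
  then have pe: "pos_eigs \<rho> = {c}"
    unfolding pos_eigs_def ev using ev_cases c0 by (auto dest: ev_cases)
  have ord: "real (order c (char_poly \<rho>)) = 2 ^ n" unfolding as order_prod_list_linear by (rule cnt)
  show ?thesis
  proof (cases "\<alpha> = 1")
    case True
    then show ?thesis
      by (simp add: renyi_entropy_def pe ord Rec log_divide log_nat_power)
  next
    case False
    have "tr_power \<rho> \<alpha> = 2 ^ n * (1 / 2 ^ n) powr \<alpha>"
      by (simp add: tr_power_def pe ord Rec)
    also have "\<dots> = 2 powr (real n * (1 - \<alpha>))"
      by (simp add: powr_realpow[symmetric] powr_divide powr_powr powr_diff[symmetric] algebra_simps)
    finally have "log 2 (tr_power \<rho> \<alpha>) = real n * (1 - \<alpha>)" by simp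
    then show ?thesis using False by (simp add: renyi_entropy_def)
  qed
qed

section \<open>Hybridized pairs of modes\<close>

lemma lop_cong:
  assumes "\<And>i. i < n \<Longrightarrow> p i = p' i" and "\<And>i. i < n \<Longrightarrow> q i = q' i"
  shows "lop n p q = lop n p' q'"
  using assms by (simp add: lop_def fun_eq_iff)

lemma lopL_cong:
  assumes "\<And>i. i < n \<Longrightarrow> p i = p' i" and "\<And>i. i < n \<Longrightarrow> q i = q' i"
  shows "lopL n p q = lopL n p' q'"
  using lop_cong[OF assms] by (simp add: lopL_def fun_eq_iff)

lemma lopR_cong:
  assumes "\<And>i. i < n \<Longrightarrow> p i = p' i" and "\<And>i. i < n \<Longrightarrow> q i = q' i"
  shows "lopR n p q = lopR n p' q'"
  using lop_cong[OF assms] by (simp add: lopR_def fun_eq_iff)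

lemma crea_coeff_scale: "lop n (\<lambda>_. 0) (\<lambda>i. c * w i) \<phi> x = c * lop n (\<lambda>_. 0) w \<phi> x"
  by (simp add: lop_def sum_distrib_left algebra_simps)

lemma cL_coeff_scale: "cL n (\<lambda>i. c * w i) K y z = c * cL n w K y z"
  and cR_coeff_scale: "cR n (\<lambda>i. c * w i) K y z = c * cR n w K y z"
  by (simp_all add: lopL_def lopR_def crea_coeff_scale)

lemma onlist_map:
  assumes "onb n W" and "distinct ks" and "set ks \<subseteq> {..<n}"
  shows "onlist n (map W ks)"
  unfolding onlist_def
proof (intro allI impI)
  fix i j assume ij: "i < length (map W ks)" "j < length (map W ks)"
  then have "ks ! i \<in> {..<n}" "ks ! j \<in> {..<n}" using assms(3) by (auto simp: subset_iff)
  then show "ip n (map W ks ! i) (map W ks ! j) = of_bool (i = j)"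
    using assms(1,2) ij by (simp add: onb_def nth_eq_iff_index_eq)
qed

lemma quad_adjoint:
  assumes "\<And>i j. i < n \<Longrightarrow> j < n \<Longrightarrow> cnj (h i j) = h j i"
  shows "ip (2 ^ n) (quad n h \<phi>) \<chi> = ip (2 ^ n) \<phi> (quad n h \<chi>)"
proof -
  have "ip (2 ^ n) (quad n h \<phi>) \<chi> = (\<Sum>i<n. \<Sum>j<n. h i j * ip (2 ^ n) \<phi> (fop True j (fop False i \<chi>)))"
    unfolding quad_def[abs_def] ip_sum_left ip_scale_left by (intro sum.cong refl) (simp add: fop_adjoint)
  also have "\<dots> = (\<Sum>i<n. \<Sum>j<n. cnj (h j i) * ip (2 ^ n) \<phi> (fop True j (fop False i \<chi>)))"
    using assms by (intro sum.cong refl) simp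
  also have "\<dots> = (\<Sum>j<n. \<Sum>i<n. cnj (h j i) * ip (2 ^ n) \<phi> (fop True j (fop False i \<chi>)))"
    by (rule sum.swap)
  also have "\<dots> = ip (2 ^ n) \<phi> (quad n h \<chi>)"
    unfolding quad_def[abs_def] ip_sum_right ip_scale_right ..
  finally show ?thesis .
qed

context bipartition begin

lemma N_eq: "N = b + a"
proof -
  have "card (A \<union> B) = card A + card B" using fin disj by (rule card_Un_disjoint)
  then show ?thesis by (simp add: un)
qed

text \<open>Glues a vector \<open>f\<close> on A and a vector \<open>g\<close> on B. Writing the
  lookup of the position of \<open>i\<close> as a sum avoids inverting the sorted lists.\<close>

definition mix :: "(nat \<Rightarrow> complex) \<Rightarrow> (nat \<Rightarrow> complex) \<Rightarrow> nat \<Rightarrow> complex" where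
  "mix f g i = (\<Sum>k<b. if k < b \<and> sB ! k = i then g k else 0) + (\<Sum>k<a. if k < a \<and> sA ! k = i then f k else 0)"

lemma mix_B [simp]: "k < b \<Longrightarrow> mix f g (sB ! k) = g k"
proof -
  assume k: "k < b"
  have "(\<Sum>l<b. if l < b \<and> sB ! l = sB ! k then g l else 0) = (\<Sum>l<b. if l = k then g l else 0)"
    using k by (intro sum.cong) (auto simp: sB_eq_iff)
  moreover have "(\<Sum>l<a. if l < a \<and> sA ! l = sB ! k then f l else 0) = 0"
    using k by (intro sum.neutral) (auto simp: sA_neq_sB)
  ultimately show ?thesis using k by (simp add: mix_def)
qed

lemma mix_A [simp]: "k < a \<Longrightarrow> mix f g (sA ! k) = f k"
proof -
  assume k: "k < a"
  have "(\<Sum>l<a. if l < a \<and> sA ! l = sA ! k then f l else 0) = (\<Sum>l<a. if l = k then f l else 0)"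
    using k by (intro sum.cong) (auto simp: sA_eq_iff)
  moreover have "(\<Sum>l<b. if l < b \<and> sB ! l = sA ! k then g l else 0) = 0"
    using k by (intro sum.neutral) (auto simp: sA_neq_sB[symmetric])
  ultimately show ?thesis using k by (simp add: mix_def)
qed

lemma ip_mix: "ip N (mix f g) (mix f' g') = ip b g g' + ip a f f'"
  by (simp add: ip_def sum_split)

lemma less_N_cases:
  assumes "i < N"
  obtains k where "k < b" "i = sB ! k" | k where "k < a" "i = sA ! k"
proof -
  have "i \<in> A \<or> i \<in> B" using assms un by auto
  then show thesis using that sA sB unfolding bij_betw_def by (metis imageE lessThan_iff)
qed

lemma bipartite_crea_mix:
  "bipartite (crea N (mix f g) \<phi>) = (\<lambda>y z. cL b g (bipartite \<phi>) y z + par b (cR a f (bipartite \<phi>)) y z)"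
proof -
  have "lopL b (\<lambda>k. 0) (\<lambda>k. mix f g (sB ! k)) = cL b g"
    by (rule lopL_cong) simp_all
  moreover have "lopR a (\<lambda>k. 0) (\<lambda>k. mix f g (sA ! k)) = cR a f"
    by (rule lopR_cong) simp_all
  ultimately show ?thesis unfolding crea_def bipartite_lop by simp
qed

end

locale svd_modes = bipartition +
  fixes u v :: "nat \<Rightarrow> nat \<Rightarrow> complex"
  assumes ba: "b \<le> a" and u: "onb a u" and v: "onb b v"
begin

definition r :: complex where "r = complex_of_real (1 / sqrt 2)"

lemma r: "cnj r = r" "r * r = 1 / 2" "(- r) * (- r) = 1 / 2" "cnj (- r) = - r"
proof -
  show "r * r = 1 / 2" unfolding r_def of_real_mult[symmetric] by simp
  then show "(- r) * (- r) = 1 / 2" by simp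
qed (simp_all add: r_def)

definition W :: "nat \<Rightarrow> nat \<Rightarrow> complex" where
  "W k = (if k < 2 * b then mix (\<lambda>i. (if even k then r else - r) * u (k div 2) i) (\<lambda>i. r * v (k div 2) i)
          else mix (u (k - b)) (\<lambda>_. 0))"

lemma onb_W: "onb N W"
  unfolding onb_def
proof (intro allI impI)
  fix k l assume k: "k < N" and l: "l < N"
  have uu: "ip a (u i) (u j) = of_bool (i = j)" if "i < a" "j < a" for i j using u that by (simp add: onb_def)
  have vv: "ip b (v i) (v j) = of_bool (i = j)" if "i < b" "j < b" for i j using v that by (simp add: onb_def)
  have rr: "r * (r * x) = x / 2" for x using r(2) by (simp only: mult.assoc[symmetric]) simp
  have half: "k div 2 < b" if "k < 2 * b" for k using that by auto
  show "ip N (W k) (W l) = of_bool (k = l)"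
  proof (cases "k < 2 * b"; cases "l < 2 * b")
    assume *: "k < 2 * b" "l < 2 * b"
    \<comment> \<open>Within the pairs, index equality splits into equal pair and equal sign; for
      one pair with opposite signs the B-part \<open>1 / 2\<close> and the A-part
      \<open>- 1 / 2\<close> cancel.\<close>
    have kl: "k = l \<longleftrightarrow> k div 2 = l div 2 \<and> even k = even l"
      by (metis even_two_times_div_two odd_two_times_div_two_succ)
    show ?thesis
      using * ba half[OF *(1)] half[OF *(2)] unfolding kl
      by (simp add: W_def ip_mix ip_scale_left ip_scale_right uu vv r rr)
  next
    assume *: "k < 2 * b" "\<not> l < 2 * b"
    then have "k div 2 < a" "l - b < a" "k div 2 \<noteq> l - b" "k \<noteq> l" using ba l N_eq by auto
    then show ?thesis using * by (simp add: W_def ip_mix ip_scale_left uu)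
  next
    assume *: "\<not> k < 2 * b" "l < 2 * b"
    then have "l div 2 < a" "k - b < a" "k - b \<noteq> l div 2" "k \<noteq> l" using ba k N_eq by auto
    then show ?thesis using * by (simp add: W_def ip_mix ip_scale_right uu)
  next
    assume *: "\<not> k < 2 * b" "\<not> l < 2 * b"
    then have "l - b < a" "k - b < a" "k - b = l - b \<longleftrightarrow> k = l" using ba k l N_eq by auto
    then show ?thesis using * by (simp add: W_def ip_mix uu)
  qed
qed

text \<open>Contains only the occupied modes from \<open>m\<close> on. Lower modes are created
  later, so inductions run downwards from the vacuum at \<open>N\<close> to the full state at
  0.\<close>

definition state :: "(nat \<Rightarrow> bool) \<Rightarrow> nat \<Rightarrow> nat \<Rightarrow> complex" where
  "state S m = slater N (map W (filter S [m..<N]))"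

lemma state_N: "state S N = vac"
  by (simp add: state_def)

lemma state_step: "m < N \<Longrightarrow> state S m = (if S m then crea N (W m) (state S (Suc m)) else state S (Suc m))"
  by (simp add: state_def upt_conv_Cons)

definition singles :: "(nat \<Rightarrow> bool) \<Rightarrow> nat \<Rightarrow> nat" where
  "singles S k = card {l. k \<le> l \<and> l < b \<and> S (2 * l) \<noteq> S (Suc (2 * l))}"

lemma singles_b: "singles S b = 0"
  by (simp add: singles_def)

lemma singles_step:
  assumes "k < b"
  shows "singles S k = (if S (2 * k) \<noteq> S (Suc (2 * k)) then Suc (singles S (Suc k)) else singles S (Suc k))"
proof -
  have "{l. k \<le> l \<and> l < b \<and> S (2 * l) \<noteq> S (Suc (2 * l))}
     = (if S (2 * k) \<noteq> S (Suc (2 * k)) then insert k {l. Suc k \<le> l \<and> l < b \<and> S (2 * l) \<noteq> S (Suc (2 * l))}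
        else {l. Suc k \<le> l \<and> l < b \<and> S (2 * l) \<noteq> S (Suc (2 * l))})"
    using assms by (auto simp: Suc_le_eq order_less_le)
  then show ?thesis unfolding singles_def by simp
qed

lemma ip_u: "i < a \<Longrightarrow> j < a \<Longrightarrow> ip a (u i) (u j) = of_bool (i = j)"
  and ip_v: "i < b \<Longrightarrow> j < b \<Longrightarrow> ip b (v i) (v j) = of_bool (i = j)"
  using u v by (simp_all add: onb_def)

text \<open>Zero modes lie entirely in A, so filling them creates no entanglement and
  \<open>c\<close> stays 1. All \<open>v\<close> vectors and the \<open>u\<close> vectors below
  \<open>m - b\<close> remain empty.\<close>

lemma ent_inv_state_tail:
  assumes "m \<le> N" and "2 * b \<le> m"
  shows "ent_inv b a 1 (v ` {..<b}) (u ` {..<m - b}) (bipartite (state S m))"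
  using assms
proof (induction m rule: inc_induct)
  case base
  show ?case using ent_inv_mono[OF ent_inv_vac] by (simp add: state_N)
next
  case (step m)
  have inv: "ent_inv b a 1 (v ` {..<b}) (u ` {..<Suc m - b}) (bipartite (state S (Suc m)))"
    using step by simp
  have m: "m - b < a" "m - b < Suc m - b" using step.hyps step.prems N_eq ba by auto
  have sub: "u ` {..<m - b} \<subseteq> u ` {..<Suc m - b}" by (intro image_mono) auto
  show ?case
  proof (cases "S m")
    case True
    have "cL b (\<lambda>_. 0) K = (\<lambda>_ _. 0)" for K by (simp add: lopL_def lop_def fun_eq_iff)
    then have "bipartite (state S m) = par b (cR a (u (m - b)) (bipartite (state S (Suc m))))"
      using step True by (simp add: state_step W_def bipartite_crea_mix)
    moreover have "ent_inv b a 1 (v ` {..<b}) (u ` {..<m - b}) (par b (cR a (u (m - b)) (bipartite (state S (Suc m)))))"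
      by (rule ent_inv_cR[OF inv]) (use m sub in \<open>auto simp: ip_u\<close>)
    ultimately show ?thesis by simp
  next
    case False
    then show ?thesis using step ent_inv_mono[OF inv order_refl sub] by (simp add: state_step)
  qed
qed

text \<open>Each pair has four occupations: exactly one hybrid halves \<open>c\<close>, both or none
  preserve it. Thus \<open>c\<close> counts the singly occupied pairs, and at \<open>k = 0\<close>
  the invariant describes the whole state.\<close>

lemma ent_inv_state_pairs:
  assumes "k \<le> b"
  shows "ent_inv b a (1 / 2 ^ singles S k) (v ` {..<k}) (u ` {..<k}) (bipartite (state S (2 * k)))"
  using assms
proof (induction k rule: inc_induct)
  case base
  have "2 * b \<le> N" using ba N_eq by simp
  then show ?case using ent_inv_state_tail[of "2 * b" S] by (simp add: singles_b mult_2)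
next
  case (step k)
  let ?K = "bipartite (state S (2 * Suc k))"
  have k: "k < b" "k < a" "2 * k < N" "Suc (2 * k) < N" "2 * k < 2 * b" "Suc (2 * k) < 2 * b"
    using step.hyps ba N_eq by auto
  note inv = step.IH
  have sub: "v ` {..<k} \<subseteq> v ` {..<Suc k}" "u ` {..<k} \<subseteq> u ` {..<Suc k}" by (auto intro!: image_mono)
  have orth: "\<forall>v'\<in>v ` {..<k}. ip b (v k) v' = 0" "\<forall>u'\<in>u ` {..<k}. ip a (u k) u' = 0"
    "ip b (v k) (v k) = 1" "ip a (u k) (u k) = 1" "v k \<in> v ` {..<Suc k}" "u k \<in> u ` {..<Suc k}"
    using k by (auto simp: ip_u ip_v)
  define F where "F t K = (\<lambda>y z. r * cL b (v k) K y z + t * par b (cR a (u k) K) y z)" for t K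
  have even: "bipartite (crea N (W (2 * k)) \<phi>) = F r (bipartite \<phi>)"
    and odd: "bipartite (crea N (W (Suc (2 * k))) \<phi>) = F (- r) (bipartite \<phi>)" for \<phi>
    using k cR_coeff_scale[of a "- r" "u k"] by (simp_all add: W_def bipartite_crea_mix F_def fun_eq_iff cL_coeff_scale cR_coeff_scale par_def mult.left_commute)
  have state: "bipartite (state S (2 * k)) = (if S (2 * k) then F r else id) ((if S (Suc (2 * k)) then F (- r) else id) ?K)"
    using k by (simp add: state_step even odd)
  have half: "(1 / 2 ^ n) / 2 = (1 / 2 ^ Suc n :: complex)" for n by simp
  consider "S (2 * k)" "S (Suc (2 * k))" | "S (2 * k)" "\<not> S (Suc (2 * k))"
    | "\<not> S (2 * k)" "S (Suc (2 * k))" | "\<not> S (2 * k)" "\<not> S (Suc (2 * k))" by blast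
  then show ?case
  proof cases
    case 1
    \<comment> \<open>A doubly occupied pair is rewritten through its constituents, each of which is
      an unentangled filling inside one factor.\<close>
    have "bipartite (state S (2 * k)) = par b (cR a (u k) (cL b (v k) ?K))"
      using 1 double_mix[of r F b "v k" a "u k" ?K] r(2) by (simp add: state F_def)
    moreover have "ent_inv b a (1 / 2 ^ singles S (Suc k)) (v ` {..<k}) (u ` {..<Suc k}) (cL b (v k) ?K)"
      by (rule ent_inv_cL[OF inv]) (use orth sub in auto)
    then have "ent_inv b a (1 / 2 ^ singles S (Suc k)) (v ` {..<k}) (u ` {..<k}) (par b (cR a (u k) (cL b (v k) ?K)))"
      by (rule ent_inv_cR) (use orth sub in auto)
    ultimately show ?thesis using 1 k by (simp add: singles_step)
  next
    case 2
    have "ent_inv b a ((1 / 2 ^ singles S (Suc k)) / 2) (v ` {..<k}) (u ` {..<k}) (F r ?K)"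
      unfolding F_def by (rule ent_inv_mix[OF inv]) (use orth sub r in auto)
    then have "ent_inv b a (1 / 2 ^ Suc (singles S (Suc k))) (v ` {..<k}) (u ` {..<k}) (F r ?K)"
      unfolding half .
    then show ?thesis using 2 k by (simp add: singles_step state del: power_Suc)
  next
    case 3
    have "ent_inv b a ((1 / 2 ^ singles S (Suc k)) / 2) (v ` {..<k}) (u ` {..<k}) (F (- r) ?K)"
      unfolding F_def by (rule ent_inv_mix[OF inv]) (use orth sub r in auto)
    then have "ent_inv b a (1 / 2 ^ Suc (singles S (Suc k))) (v ` {..<k}) (u ` {..<k}) (F (- r) ?K)"
      unfolding half .
    then show ?thesis using 3 k by (simp add: singles_step state del: power_Suc)
  next
    case 4
    then show ?thesis using ent_inv_mono[OF inv sub] k by (simp add: singles_step state)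
  qed
qed

lemma ip_state:
  shows "ip (2 ^ N) (state S 0) (state S' 0) = of_bool (\<forall>k<N. S k = S' k)"
proof (cases "\<forall>k<N. S k = S' k")
  case True
  then have "filter S [0..<N] = filter S' [0..<N]" by (intro filter_cong) auto
  then have "state S' 0 = state S 0" by (simp add: state_def)
  moreover have "onlist N (map W (filter S [0..<N]))"
    by (rule onlist_map[OF onb_W]) auto
  ultimately show ?thesis using True slater_norm by (simp add: state_def)
next
  case False
  have orth: "ip (2 ^ N) (state S 0) (state S' 0) = 0" if k: "k < N" "S k" "\<not> S' k" for k S S'
    unfolding state_def
  proof (rule ip_slater_eq_0[of _ "W k"])
    show "ip N (W k) (W k) = 1" using onb_W k by (simp add: onb_def)
    show "W k \<in> set (map W (filter S [0..<N]))" using k by auto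
    show "\<forall>w'\<in>set (map W (filter S' [0..<N])). ip N w' (W k) = 0"
      using onb_W k by (auto simp: onb_def)
  qed
  obtain k where k: "k < N" "S k \<noteq> S' k" using False by blast
  have "ip (2 ^ N) (state S 0) (state S' 0) = 0"
  proof (cases "S k")
    case True
    then show ?thesis using k orth[of k S S'] by simp
  next
    case False
    then have "ip (2 ^ N) (state S' 0) (state S 0) = 0" using k orth[of k S' S] by simp
    then show ?thesis by (metis cnj_ip complex_cnj_zero)
  qed
  then show ?thesis using False by simp
qed

lemma quasifree_state: "quasifree N (state S 0)"
  unfolding state_def by (rule quasifree_slater, rule onlist_map[OF onb_W]) auto

lemma quad_state:
  assumes "\<And>k i. k < N \<Longrightarrow> i < N \<Longrightarrow> (\<Sum>j<N. h i j * W k j) = \<epsilon> k * W k i"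
  shows "quad N h (state S 0) x = (\<Sum>k<N. if S k then \<epsilon> k else 0) * state S 0 x"
proof -
  have "(\<Sum>k\<leftarrow>filter S [0..<N]. \<epsilon> k) = (\<Sum>k<N. if S k then \<epsilon> k else 0)"
    by (simp add: sum_list_map_filter' interv_sum_list_conv_sum_set_nat lessThan_atLeast0)
  then show ?thesis
    unfolding state_def using quad_slater[of "filter S [0..<N]" N h W \<epsilon> x] assms by simp
qed

definition energy :: "(nat \<Rightarrow> real) \<Rightarrow> nat \<Rightarrow> real" where
  "energy s k = (if k < 2 * b then (if even k then s (k div 2) else - s (k div 2)) else 0)"

text \<open>Since \<open>h\<close> only connects A with B, it sends \<open>v k\<close> to
  \<open>s k\<close> times \<open>u k\<close> and, by Hermiticity, \<open>u k\<close> to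
  \<open>s k\<close> times \<open>v k\<close>. Sum and difference are eigenvectors with opposite
  energies, and surplus \<open>u k\<close> are annihilated.\<close>

lemma W_eigen:
  assumes AA: "\<And>i j. i \<in> A \<Longrightarrow> j \<in> A \<Longrightarrow> h i j = 0" and BB: "\<And>i j. i \<in> B \<Longrightarrow> j \<in> B \<Longrightarrow> h i j = 0"
    and herm: "\<And>i j. i < N \<Longrightarrow> j < N \<Longrightarrow> cnj (h i j) = h j i"
  defines "X \<equiv> \<lambda>i j. h (sA ! i) (sB ! j)"
  assumes Xv: "\<And>k i. k < b \<Longrightarrow> i < a \<Longrightarrow> mv b X (v k) i = of_real (s k) * u k i"
    and Xu: "\<And>k j. k < a \<Longrightarrow> j < b \<Longrightarrow> mv a (adj X) (u k) j = (if k < b then of_real (s k) * v k j else 0)"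
    and k: "k < N" and i: "i < N"
  shows "(\<Sum>j<N. h i j * W k j) = of_real (energy s k) * W k i"
proof -
  have hA: "(\<Sum>j<N. h (sA ! i) j * mix f g j) = mv b X g i" if "i < a" for i f g
    using that by (simp add: sum_split mv_def X_def AA sA_in)
  have hB: "(\<Sum>j<N. h (sB ! i) j * mix f g j) = mv a (adj X) f i" if "i < b" for i f g
    using that by (simp add: sum_split mv_def X_def adj_def BB sB_in herm sA_less_N sB_less_N)
  have mv0: "mv n Y (\<lambda>_. 0) i = 0" for n Y i by (simp add: mv_def)
  show ?thesis
  proof (cases "k < 2 * b")
    case True
    then have kb: "k div 2 < b" "k div 2 < a" using ba by auto
    from i show ?thesis
      by (cases rule: less_N_cases) (auto simp: W_def True hA hB mv_scale Xv Xu kb energy_def)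
  next
    case False
    then have kb: "k - b < a" "\<not> k - b < b" using k N_eq by auto
    from i show ?thesis
      by (cases rule: less_N_cases) (auto simp: W_def False hA hB mv0 Xu kb energy_def)
  qed
qed

end

section \<open>Matrix form\<close>

lemma mult_vec_fun_index:
  "M \<in> carrier_mat m n \<Longrightarrow> y < m \<Longrightarrow> (M *\<^sub>v vec n \<phi>) $ y = (\<Sum>x<n. M $$ (y, x) * \<phi> x)"
  by (auto simp: scalar_prod_def lessThan_atLeast0 intro!: sum.cong)

lemma mat_adjoint_index:
  "i < dim_col M \<Longrightarrow> j < dim_row M \<Longrightarrow> mat_adjoint M $$ (i, j) = conjugate (M $$ (j, i))"
  by (simp add: mat_adjoint_def mat_of_rows_index)

text \<open>Bridges the entry condition of \<open>fann\<close>, phrased from the column index, and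
  \<open>fop\<close>, phrased from the row index.\<close>

lemma bit_diff_iff_flip:
  fixes x y :: nat
  shows "bit x j \<and> y = x - 2 ^ j \<longleftrightarrow> \<not> bit y j \<and> x = flip_bit j y"
proof -
  have flip: "flip_bit j w = w + 2 ^ j" if "\<not> bit w j" for w :: nat
    using that by (simp add: flip_bit_eq_if set_bit_eq)
  show ?thesis
  proof
    assume *: "bit x j \<and> y = x - 2 ^ j"
    then have "y = flip_bit j x" using flip[of "flip_bit j x"] by simp
    then show "\<not> bit y j \<and> x = flip_bit j y" using * by simp
  next
    assume *: "\<not> bit y j \<and> x = flip_bit j y"
    then have "bit x j" by simp
    then show "bit x j \<and> y = x - 2 ^ j" using * flip[of y] by simp
  qed
qed

lemma mat_adjoint_carrier: "M \<in> carrier_mat m n \<Longrightarrow> mat_adjoint M \<in> carrier_mat n m"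
  using mat_of_rows_carrier(1)[of "dim_row M" "map conjugate (cols M)"]
  unfolding mat_adjoint_def by auto

lemma op_of_carrier [simp]: "op_of N w \<in> carrier_mat (2 ^ N) (2 ^ N)"
  by (simp add: op_of_def fann_def fcre_def mat_adjoint_carrier)

lemma op_of_dim [simp]: "dim_row (op_of N w) = 2 ^ N" "dim_col (op_of N w) = 2 ^ N"
  by (rule carrier_matD[OF op_of_carrier])+

lemma op_of_index:
  assumes "x < 2 ^ N" "y < 2 ^ N"
  shows "op_of N (j, t) $$ (y, x) = (if bit y j = t \<and> x = flip_bit j y then jw_sign y j else 0)"
proof (cases t)
  case False
  have "fann N j $$ (y, x) = (if bit x j \<and> y = x - 2 ^ j then jw_sign x j else 0)"
    using assms by (simp add: fann_def)
  then show ?thesis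
    using False by (auto simp: op_of_def bit_diff_iff_flip jw_sign_flip_bit)
next
  case True
  have "fcre N j $$ (y, x) = cnj (fann N j $$ (x, y))"
    using assms by (simp add: fcre_def mat_adjoint_index fann_def)
  also have "\<dots> = (if bit y j \<and> x = y - 2 ^ j then jw_sign y j else 0)"
    using assms by (simp add: fann_def)
  also have "bit y j \<and> x = y - 2 ^ j \<longleftrightarrow> bit y j \<and> x = flip_bit j y"
    unfolding bit_diff_iff_flip by auto
  finally show ?thesis using True by (simp add: op_of_def)
qed

lemma op_of_mult_vec:
  assumes j: "j < N"
  shows "op_of N (j, t) *\<^sub>v vec (2 ^ N) \<phi> = vec (2 ^ N) (fop t j \<phi>)"
proof (intro eq_vecI)
  fix y assume "y < dim_vec (vec (2 ^ N) (fop t j \<phi>))"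
  then have y: "y < 2 ^ N" by simp
  have "(op_of N (j, t) *\<^sub>v vec (2 ^ N) \<phi>) $ y = (\<Sum>x<2 ^ N. op_of N (j, t) $$ (y, x) * \<phi> x)"
    by (rule mult_vec_fun_index[OF op_of_carrier y])
  also have "\<dots> = (\<Sum>x<2 ^ N. if x = flip_bit j y then fop t j \<phi> y else 0)"
    using y by (intro sum.cong) (auto simp: op_of_index fop_def)
  also have "\<dots> = fop t j \<phi> y" using flip_bit_less[OF y j] by simp
  finally show "(op_of N (j, t) *\<^sub>v vec (2 ^ N) \<phi>) $ y = vec (2 ^ N) (fop t j \<phi>) $ y" using y by simp
qed simp

lemma word_op_carrier [simp]: "word_op N ops \<in> carrier_mat (2 ^ N) (2 ^ N)"
  by (induction ops) (auto simp: word_op_def intro: mult_carrier_mat[OF op_of_carrier])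

lemma word_op_mult_vec:
  assumes "set (map fst ops) \<subseteq> {..<N}"
  shows "word_op N ops *\<^sub>v vec (2 ^ N) \<phi> = vec (2 ^ N) (fword ops \<phi>)"
  using assms
proof (induction ops)
  case (Cons w ops)
  obtain j t where w: "w = (j, t)" by (cases w)
  have "word_op N (w # ops) *\<^sub>v vec (2 ^ N) \<phi> = op_of N w *\<^sub>v (word_op N ops *\<^sub>v vec (2 ^ N) \<phi>)"
    using assoc_mult_mat_vec[OF op_of_carrier word_op_carrier vec_carrier] by (simp add: word_op_def)
  then show ?case using Cons by (simp add: w op_of_mult_vec fword_def)
qed (simp add: word_op_def fword_def)

text \<open>Matrix and function expectations are compared only for modes below \<open>N\<close>.
  This suffices because \<open>wick\<close> evaluates its first argument only on words over the
  given letters.\<close>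

lemma wick_cong:
  assumes "\<And>ops'. set ops' \<subseteq> set ops \<Longrightarrow> E ops' = E' ops'"
  shows "wick E ops = wick E' ops"
  using assms
proof (induction "length ops" arbitrary: ops rule: less_induct)
  case less
  show ?case
  proof (cases ops)
    case (Cons w rest)
    show ?thesis
    proof (cases rest)
      case (Cons p rest')
      have "wick E (take k rest @ drop (Suc k) rest) = wick E' (take k rest @ drop (Suc k) rest)"
        if k: "k < length rest" for k
      proof (rule less.hyps)
        have "set (take k rest @ drop (Suc k) rest) \<subseteq> set ops"
          using set_take_subset[of k rest] set_drop_subset[of "Suc k" rest] \<open>ops = w # rest\<close> by auto
        then show "E ops' = E' ops'" if "set ops' \<subseteq> set (take k rest @ drop (Suc k) rest)" for ops'
          using less.prems that by (meson order_trans)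
      qed (use k \<open>ops = w # rest\<close> in auto)
      moreover have "E [w, rest ! k] = E' [w, rest ! k]" if "k < length rest" for k
        using that by (intro less.prems) (simp add: \<open>ops = w # rest\<close>)
      ultimately show ?thesis unfolding \<open>ops = w # rest\<close> Cons wick.simps
        by (intro sum.cong refl) (simp add: Cons[symmetric])
    qed (simp add: \<open>ops = w # rest\<close>)
  qed simp
qed

lemma pure_gaussian_vec:
  assumes "quasifree N \<psi>" and norm: "ip (2 ^ N) \<psi> \<psi> = 1"
  shows "pure_gaussian N (vec (2 ^ N) \<psi>)"
proof -
  have ex: "expect N (vec (2 ^ N) \<psi>) ops = ip (2 ^ N) (fword ops \<psi>) \<psi>" if "set (map fst ops) \<subseteq> {..<N}" for ops
    using that by (simp add: expect_def word_op_mult_vec scalar_prod_conjugate_vec)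
  have "expect N (vec (2 ^ N) \<psi>) ops = wick (expect N (vec (2 ^ N) \<psi>)) ops"
    if ops: "set (map fst ops) \<subseteq> {..<N}" for ops
  proof -
    have "wick (expect N (vec (2 ^ N) \<psi>)) ops = wick (\<lambda>ops. ip (2 ^ N) (fword ops \<psi>) \<psi>) ops"
      by (rule wick_cong, rule ex) (use ops in auto)
    then show ?thesis using ex[OF ops] quasifree_wick[OF assms ops] by simp
  qed
  then show ?thesis by (simp add: pure_gaussian_def scalar_prod_conjugate_vec norm)
qed

lemma hop_mult_vec:
  assumes "i < N" "j < N" "y < 2 ^ N"
  shows "(\<Sum>x<2 ^ N. (fcre N i * fann N j) $$ (y, x) * \<phi> x) = fop True i (fop False j \<phi>) y"
proof -
  have c: "fcre N i = op_of N (i, True)" "fann N j = op_of N (j, False)" by (simp_all add: op_of_def)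
  have "(fcre N i * fann N j) *\<^sub>v vec (2 ^ N) \<phi> = vec (2 ^ N) (fop True i (fop False j \<phi>))"
    unfolding c using assms assoc_mult_mat_vec[OF op_of_carrier op_of_carrier vec_carrier] by (simp add: op_of_mult_vec)
  then have "((fcre N i * fann N j) *\<^sub>v vec (2 ^ N) \<phi>) $ y = fop True i (fop False j \<phi>) y" using assms by simp
  moreover have "fcre N i * fann N j \<in> carrier_mat (2 ^ N) (2 ^ N)"
    unfolding c by (rule mult_carrier_mat[OF op_of_carrier op_of_carrier])
  ultimately show ?thesis using mult_vec_fun_index[OF _ assms(3)] by metis
qed

lemma mat_mult_vec_fun:
  "mat n n (\<lambda>(y, x). M y x) *\<^sub>v vec n \<phi> = vec n (\<lambda>y. \<Sum>x<n. M y x * \<phi> x)"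
  by (intro eq_vecI) (auto simp: scalar_prod_def lessThan_atLeast0 intro!: sum.cong)

lemma Nop_mult_vec:
  "Nop N *\<^sub>v vec (2 ^ N) \<phi> = vec (2 ^ N) (quad N (\<lambda>i j. of_bool (i = j)) \<phi>)"
proof (intro eq_vecI)
  fix y assume "y < dim_vec (vec (2 ^ N) (quad N (\<lambda>i j. of_bool (i = j)) \<phi>))"
  then have y: "y < 2 ^ N" by simp
  have "(Nop N *\<^sub>v vec (2 ^ N) \<phi>) $ y = (\<Sum>x<2 ^ N. \<Sum>j<N. (fcre N j * fann N j) $$ (y, x) * \<phi> x)"
    unfolding Nop_def mat_mult_vec_fun using y by (simp add: sum_distrib_right)
  also have "\<dots> = (\<Sum>j<N. \<Sum>x<2 ^ N. (fcre N j * fann N j) $$ (y, x) * \<phi> x)" by (rule sum.swap)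
  also have "\<dots> = (\<Sum>j<N. fop True j (fop False j \<phi>) y)"
    using y by (intro sum.cong) (auto simp: hop_mult_vec)
  also have "\<dots> = quad N (\<lambda>i j. of_bool (i = j)) \<phi> y"
    unfolding quad_def
  proof (intro sum.cong refl)
    fix i assume "i \<in> {..<N}"
    moreover have "(\<Sum>j<N. of_bool (i = j) * fop True i (fop False j \<phi>) y)
        = (\<Sum>j<N. if i = j then fop True i (fop False j \<phi>) y else 0)" by (intro sum.cong) auto
    ultimately show "fop True i (fop False i \<phi>) y = (\<Sum>j<N. of_bool (i = j) * fop True i (fop False j \<phi>) y)" by simp
  qed
  finally show "(Nop N *\<^sub>v vec (2 ^ N) \<phi>) $ y = vec (2 ^ N) (quad N (\<lambda>i j. of_bool (i = j)) \<phi>) $ y" using y by simp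
qed (simp add: Nop_def)

context bipartition begin

text \<open>The Hermitian conjugate terms are the block of \<open>h\<close> from A to B, and the two
  diagonal blocks vanish, so the sum over A and B extends to the full one-particle sum.\<close>

lemma HF_mult_vec:
  assumes AA: "\<And>i j. i \<in> A \<Longrightarrow> j \<in> A \<Longrightarrow> h $$ (i, j) = 0" and BB: "\<And>i j. i \<in> B \<Longrightarrow> j \<in> B \<Longrightarrow> h $$ (i, j) = 0"
    and herm: "\<And>i j. i < N \<Longrightarrow> j < N \<Longrightarrow> cnj (h $$ (i, j)) = h $$ (j, i)"
  shows "HF N A B h *\<^sub>v vec (2 ^ N) \<phi> = vec (2 ^ N) (quad N (\<lambda>i j. h $$ (i, j)) \<phi>)"
proof (intro eq_vecI)
  fix y assume "y < dim_vec (vec (2 ^ N) (quad N (\<lambda>i j. h $$ (i, j)) \<phi>))"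
  then have y: "y < 2 ^ N" by simp
  have less: "i \<in> A \<Longrightarrow> i < N" "i \<in> B \<Longrightarrow> i < N" for i using un by auto
  define g where "g i j = fop True i (fop False j \<phi>) y" for i j
  have "(HF N A B h *\<^sub>v vec (2 ^ N) \<phi>) $ y = (\<Sum>x<2 ^ N. \<Sum>i\<in>A. \<Sum>j\<in>B.
      h $$ (i, j) * ((fcre N i * fann N j) $$ (y, x) * \<phi> x) + cnj (h $$ (i, j)) * ((fcre N j * fann N i) $$ (y, x) * \<phi> x))"
    unfolding HF_def mat_mult_vec_fun using y by (simp add: sum_distrib_right distrib_right mult.assoc)
  also have "\<dots> = (\<Sum>i\<in>A. \<Sum>j\<in>B. \<Sum>x<2 ^ N.
      h $$ (i, j) * ((fcre N i * fann N j) $$ (y, x) * \<phi> x) + cnj (h $$ (i, j)) * ((fcre N j * fann N i) $$ (y, x) * \<phi> x))"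
    unfolding sum.swap[of _ _ "{..<2 ^ N}"] ..
  also have "\<dots> = (\<Sum>i\<in>A. \<Sum>j\<in>B. h $$ (i, j) * g i j + h $$ (j, i) * g j i)"
  proof (intro sum.cong refl)
    fix i j assume "i \<in> A" "j \<in> B"
    then have ij: "i < N" "j < N" using less by auto
    show "(\<Sum>x<2 ^ N. h $$ (i, j) * ((fcre N i * fann N j) $$ (y, x) * \<phi> x) + cnj (h $$ (i, j)) * ((fcre N j * fann N i) $$ (y, x) * \<phi> x))
        = h $$ (i, j) * g i j + h $$ (j, i) * g j i"
      unfolding sum.distrib sum_distrib_left[symmetric] herm[OF ij] hop_mult_vec[OF ij y] hop_mult_vec[OF ij(2,1) y] g_def ..
  qed
  also have "\<dots> = (\<Sum>i\<in>A. \<Sum>j\<in>B. h $$ (i, j) * g i j) + (\<Sum>i\<in>A. \<Sum>j\<in>B. h $$ (j, i) * g j i)"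
    by (simp only: sum.distrib)
  also have "(\<Sum>i\<in>A. \<Sum>j\<in>B. h $$ (j, i) * g j i) = (\<Sum>i\<in>B. \<Sum>j\<in>A. h $$ (i, j) * g i j)"
    by (rule sum.swap)
  also have "(\<Sum>i\<in>A. \<Sum>j\<in>B. h $$ (i, j) * g i j) + (\<Sum>i\<in>B. \<Sum>j\<in>A. h $$ (i, j) * g i j)
      = (\<Sum>i<N. \<Sum>j<N. h $$ (i, j) * g i j)"
  proof -
    have sumN: "(\<Sum>i<N. f i) = sum f A + sum f B" for f :: "nat \<Rightarrow> complex"
      unfolding un[symmetric] using fin disj by (rule sum.union_disjoint)
    show ?thesis unfolding sumN by (simp add: AA BB)
  qed
  finally show "(HF N A B h *\<^sub>v vec (2 ^ N) \<phi>) $ y = vec (2 ^ N) (quad N (\<lambda>i j. h $$ (i, j)) \<phi>) $ y"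
    using y by (simp add: quad_def g_def)
qed (simp add: HF_def)

lemma reduced_state_vec:
  "reduced_state A B (vec (2 ^ N) \<phi>) = mat (2 ^ b) (2 ^ b) (\<lambda>(y, y'). ip (2 ^ a) (bipartite \<phi> y) (bipartite \<phi> y'))"
  unfolding reduced_state_def by (intro eq_matI) (auto simp: ip_def bipartite_def join_less)

lemma renyi_entropy_reduced_state:
  assumes inv: "ent_inv b a (1 / 2 ^ n) V U (bipartite \<phi>)"
  shows "renyi_entropy \<alpha> (reduced_state A B (vec (2 ^ N) \<phi>)) = real n"
proof (rule renyi_entropy_flat)
  let ?K = "bipartite \<phi>" and ?\<rho> = "reduced_state A B (vec (2 ^ N) \<phi>)"
  note inv = ent_invD[OF inv]
  show "?\<rho> \<in> carrier_mat (2 ^ b) (2 ^ b)" by (simp add: reduced_state_vec)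
  show "(\<Sum>i<2 ^ b. ?\<rho> $$ (i, i)) = 1" using inv(2) by (simp add: reduced_state_vec hs_def)
  show "?\<rho> * ?\<rho> = complex_of_real (1 / 2 ^ n) \<cdot>\<^sub>m ?\<rho>"
  proof (intro eq_matI)
    fix y y' assume "y < dim_row (complex_of_real (1 / 2 ^ n) \<cdot>\<^sub>m ?\<rho>)" "y' < dim_col (complex_of_real (1 / 2 ^ n) \<cdot>\<^sub>m ?\<rho>)"
    then have y: "y < 2 ^ b" "y' < 2 ^ b" by (simp_all add: reduced_state_vec)
    have "(?\<rho> * ?\<rho>) $$ (y, y') = (\<Sum>l<2 ^ b. ip (2 ^ a) (?K y) (?K l) * ip (2 ^ a) (?K l) (?K y'))"
      using y by (auto simp: reduced_state_vec scalar_prod_def lessThan_atLeast0 intro!: sum.cong)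
    \<comment> \<open>With \<open>\<rho> = K K\<^sup>\<dagger>\<close> the square is
      \<open>(K K\<^sup>\<dagger> K) K\<^sup>\<dagger>\<close>, where the cubic identity
      applies.\<close>
    also have "\<dots> = ip (2 ^ a) (tri b a ?K ?K ?K y) (?K y')"
      unfolding tri_eq_ip_left[abs_def] ip_sum_left ip_scale_left ..
    also have "\<dots> = 1 / 2 ^ n * ip (2 ^ a) (?K y) (?K y')"
      by (simp only: inv(1) ip_scale_left)
    finally show "(?\<rho> * ?\<rho>) $$ (y, y') = (complex_of_real (1 / 2 ^ n) \<cdot>\<^sub>m ?\<rho>) $$ (y, y')"
      using y by (simp add: reduced_state_vec)
  qed (simp_all add: reduced_state_vec)
qed

end

section \<open>Completeness, ground state and conclusion\<close>

lemma (in svd_modes) state_complete: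
  assumes "\<And>s. length s = N \<Longrightarrow> ip (2 ^ N) \<phi> (state (nth s) 0) = 0" and x: "x < 2 ^ N"
  shows "\<phi> x = 0"
proof -
  let ?L = "{s :: bool list. length s = N}"
  have L: "finite ?L" "card ?L = 2 ^ N"
    using card_lists_length_eq[of "UNIV :: bool set" N] finite_lists_length_eq[of "UNIV :: bool set" N] by simp_all
  \<comment> \<open>There are as many occupation lists as dimensions; numbering them turns the
    orthonormal family into an \<open>onb\<close>, whose expansion formula gives
    completeness.\<close>
  obtain f where f: "bij_betw f {..<2 ^ N :: nat} ?L"
    using ex_bij_betw_nat_finite[OF L(1)] L(2) by (auto simp: lessThan_atLeast0)
  have "onb (2 ^ N) (\<lambda>k. state (nth (f k)) 0)"
    unfolding onb_def ip_state
  proof (intro allI impI)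
    fix k l :: nat assume kl: "k < 2 ^ N" "l < 2 ^ N"
    then have len: "length (f k) = N" "length (f l) = N" using f by (auto simp: bij_betw_def)
    have "k = l \<longleftrightarrow> f k = f l" using f kl by (auto simp: bij_betw_def inj_on_def)
    also have "\<dots> \<longleftrightarrow> (\<forall>i<N. f k ! i = f l ! i)" using len by (auto simp: list_eq_iff_nth_eq)
    finally show "of_bool (\<forall>i<N. f k ! i = f l ! i) = (of_bool (k = l) :: complex)" by simp
  qed
  then have "\<phi> x = (\<Sum>k<2 ^ N. ip (2 ^ N) \<phi> (state (nth (f k)) 0) * state (nth (f k)) 0 x)"
    by (rule onb_expand[OF _ x])
  also have "\<dots> = 0" using bij_betwE[OF f] by (intro sum.neutral) (auto simp: assms(1))
  finally show ?thesis .
qed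

text \<open>Termwise: a mode of nonpositive energy is best occupied and one of nonnegative energy
  best left empty.\<close>

lemma (in svd_modes) sum_energy_ground_le:
  assumes "\<And>k. k < b \<Longrightarrow> s k \<ge> 0"
  shows "(\<Sum>k<N. if k < 2 * b \<and> odd k then energy s k else 0) \<le> (\<Sum>k<N. if S k then energy s k else 0)"
proof (rule sum_mono)
  fix k
  have "s (k div 2) \<ge> 0" if "k < 2 * b" using that by (intro assms) auto
  then show "(if k < 2 * b \<and> odd k then energy s k else 0) \<le> (if S k then energy s k else 0)"
    by (auto simp: energy_def)
qed

theorem theorem1:
  fixes N :: nat and A B :: "nat set" and h :: "complex mat"
  assumes "N \<ge> 1"
    and "A \<union> B = {..<N}" and "A \<inter> B = {}" and "card A \<ge> card B"
    and "h \<in> carrier_mat N N" and "mat_adjoint h = h"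
    and "\<And>i j. i \<in> A \<Longrightarrow> j \<in> A \<Longrightarrow> h $$ (i, j) = 0"
    and "\<And>i j. i \<in> B \<Longrightarrow> j \<in> B \<Longrightarrow> h $$ (i, j) = 0"
  shows "\<exists>(E :: bool list \<Rightarrow> complex vec) (n :: bool list \<Rightarrow> nat).
     (\<forall>s t. length s = N \<longrightarrow> length t = N \<longrightarrow> E s \<bullet>c E t = (if s = t then 1 else 0))
   \<and> (\<forall>v \<in> carrier_vec (2^N). (\<forall>s. length s = N \<longrightarrow> v \<bullet>c E s = 0) \<longrightarrow> v = 0\<^sub>v (2^N))
   \<and> (\<forall>s. length s = N \<longrightarrow>
        pure_gaussian N (E s)
      \<and> (\<exists>e. HF N A B h *\<^sub>v E s = e \<cdot>\<^sub>v E s)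
      \<and> (\<exists>m. Nop N *\<^sub>v E s = m \<cdot>\<^sub>v E s)
      \<and> n s \<le> card B
      \<and> (\<forall>\<alpha>::real. \<alpha> \<ge> 0 \<longrightarrow> renyi_entropy \<alpha> (reduced_state A B (E s)) = real (n s)))
   \<and> (\<exists>s. length s = N \<and> n s = card B \<and>
        (\<exists>e. HF N A B h *\<^sub>v E s = e \<cdot>\<^sub>v E s \<and>
             (\<forall>m. eigenvalue (HF N A B h) m \<longrightarrow> Re e \<le> Re m)))"
proof -
  interpret bipartition N A B by unfold_locales (use assms in auto)
  define H where "H i j = h $$ (i, j)" for i j
  have AA: "\<And>i j. i \<in> A \<Longrightarrow> j \<in> A \<Longrightarrow> H i j = 0" and BB: "\<And>i j. i \<in> B \<Longrightarrow> j \<in> B \<Longrightarrow> H i j = 0"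
    unfolding H_def using assms(7,8) by auto
  have herm: "cnj (H i j) = H j i" if "i < N" "j < N" for i j
    using mat_adjoint_index[of j h i] assms(5,6) that by (simp add: H_def)
  obtain u v and s :: "nat \<Rightarrow> real" where uv: "onb a u" "onb b v" and s: "\<And>k. k < b \<Longrightarrow> s k \<ge> 0"
    and Xv: "\<And>k i. k < b \<Longrightarrow> i < a \<Longrightarrow> mv b (\<lambda>i j. H (sA ! i) (sB ! j)) (v k) i = of_real (s k) * u k i"
    and Xu: "\<And>k j. k < a \<Longrightarrow> j < b \<Longrightarrow>
       mv a (adj (\<lambda>i j. H (sA ! i) (sB ! j))) (u k) j = (if k < b then of_real (s k) * v k j else 0)"
    using singular_value_decomposition[OF assms(4), of "\<lambda>i j. H (sA ! i) (sB ! j)"] by blast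
  interpret svd_modes N A B u v by unfold_locales (use assms(4) uv in auto)
  define \<epsilon> :: "(nat \<Rightarrow> bool) \<Rightarrow> real" where "\<epsilon> S = (\<Sum>k<N. if S k then energy s k else 0)" for S
  define E where "E l = vec (2 ^ N) (state (nth l) 0)" for l
  define n where "n l = singles (nth l) 0" for l
  have HF: "HF N A B h *\<^sub>v vec (2 ^ N) \<phi> = vec (2 ^ N) (quad N H \<phi>)" for \<phi>
    unfolding H_def[abs_def] by (rule HF_mult_vec) (use assms(7,8) herm in \<open>auto simp: H_def\<close>)
  have quad_H: "quad N H (state S 0) x = of_real (\<epsilon> S) * state S 0 x" for S x
  proof -
    have "quad N H (state S 0) x = (\<Sum>k<N. if S k then complex_of_real (energy s k) else 0) * state S 0 x"
      by (rule quad_state) (use W_eigen[OF AA BB herm Xv Xu] in auto)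
    also have "(\<Sum>k<N. if S k then complex_of_real (energy s k) else 0) = of_real (\<epsilon> S)"
      unfolding \<epsilon>_def of_real_sum by (intro sum.cong) auto
    finally show ?thesis .
  qed
  have HE: "HF N A B h *\<^sub>v E l = complex_of_real (\<epsilon> (nth l)) \<cdot>\<^sub>v E l" for l
    unfolding E_def HF by (intro eq_vecI) (auto simp: quad_H)
  have NE: "\<exists>m. Nop N *\<^sub>v E l = m \<cdot>\<^sub>v E l" for l
  proof -
    have "(\<Sum>j<N. of_bool (i = j) * W k j) = 1 * W k i" if "i < N" for i k
    proof -
      have "(\<Sum>j<N. of_bool (i = j) * W k j) = (\<Sum>j<N. if i = j then W k j else 0)"
        by (intro sum.cong) auto
      then show ?thesis using that by simp
    qed
    then have "quad N (\<lambda>i j. of_bool (i = j)) (state S 0) x = (\<Sum>k<N. if S k then 1 else 0) * state S 0 x" for S x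
      by (intro quad_state)
    then show ?thesis unfolding E_def Nop_mult_vec
      by (intro exI[of _ "\<Sum>k<N. if nth l k then 1 else 0"] eq_vecI) auto
  qed
  have norm: "ip (2 ^ N) (state S 0) (state S 0) = 1" for S by (simp add: ip_state)
  have "E l \<bullet>c E l' = (if l = l' then 1 else 0)" if "length l = N" "length l' = N" for l l'
    using that unfolding E_def scalar_prod_conjugate_vec ip_state by (auto simp: list_eq_iff_nth_eq)
  moreover have complete: "w = 0\<^sub>v (2 ^ N)"
    if w: "w \<in> carrier_vec (2 ^ N)" and orth: "\<forall>l. length l = N \<longrightarrow> w \<bullet>c E l = 0" for w
  proof -
    have ww: "w = vec (2 ^ N) (($) w)" using w by auto
    have "ip (2 ^ N) (($) w) (state (nth l) 0) = 0" if "length l = N" for l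
      using orth that unfolding E_def by (subst (asm) ww) (simp add: scalar_prod_conjugate_vec)
    then show ?thesis using w state_complete[of "($) w"] by (intro eq_vecI) auto
  qed
  moreover have "pure_gaussian N (E l)" for l
    unfolding E_def by (rule pure_gaussian_vec[OF quasifree_state norm])
  moreover have "n l \<le> card B" for l
  proof -
    have "card {k. 0 \<le> k \<and> k < b \<and> l ! (2 * k) \<noteq> l ! Suc (2 * k)} \<le> card {..<b}" by (rule card_mono) auto
    then show ?thesis by (simp add: n_def singles_def)
  qed
  moreover have "renyi_entropy \<alpha> (reduced_state A B (E l)) = real (n l)" for l \<alpha>
    using renyi_entropy_reduced_state ent_inv_state_pairs[of 0 "nth l"] by (simp add: E_def n_def)
  moreover have "\<exists>l. length l = N \<and> n l = card B \<and> (\<exists>e. HF N A B h *\<^sub>v E l = e \<cdot>\<^sub>v E l \<and>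
             (\<forall>m. eigenvalue (HF N A B h) m \<longrightarrow> Re e \<le> Re m))"
  proof -
    \<comment> \<open>Occupies exactly the modes of energy \<open>- s k\<close>. Every pair is then
      singly occupied, also when \<open>s k = 0\<close>, which gives the maximal count
      \<open>b\<close>.\<close>
    define g where "g = map (\<lambda>k. k < 2 * b \<and> odd k) [0..<N]"
    have g: "length g = N" "\<And>k. k < N \<Longrightarrow> g ! k = (k < 2 * b \<and> odd k)" by (simp_all add: g_def)
    have bN: "2 * b \<le> N" using ba N_eq by simp
    have "{k. 0 \<le> k \<and> k < b \<and> g ! (2 * k) \<noteq> g ! Suc (2 * k)} = {..<b}"
      using bN by (auto simp: g(2))
    then have "n g = card B" by (simp add: n_def singles_def)
    moreover have "\<epsilon> (nth g) \<le> Re m" if m: "eigenvalue (HF N A B h) m" for m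
    proof -
      obtain w where w: "w \<in> carrier_vec (2 ^ N)" "w \<noteq> 0\<^sub>v (2 ^ N)" "HF N A B h *\<^sub>v w = m \<cdot>\<^sub>v w"
        using m unfolding eigenvalue_def eigenvector_def by (auto simp: HF_def)
      have ww: "w = vec (2 ^ N) (($) w)" using w(1) by auto
      \<comment> \<open>By completeness an eigenvector for \<open>m\<close> overlaps some
        \<open>E l\<close>. Moving the self-adjoint operator across that inner product identifies
        \<open>m\<close> with the energy of \<open>E l\<close>, so it is enough to minimise over
        occupations.\<close>
      obtain l where l: "length l = N" "w \<bullet>c E l \<noteq> 0" using complete[OF w(1)] w(2) by blast
      then have nz: "ip (2 ^ N) (($) w) (state (nth l) 0) \<noteq> 0"
        unfolding E_def by (subst (asm) ww) (simp add: scalar_prod_conjugate_vec)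
      have "vec (2 ^ N) (quad N H (($) w)) = m \<cdot>\<^sub>v w" using w(3) HF[of "($) w"] ww by simp
      then have quad_w: "quad N H (($) w) x = m * w $ x" if "x < 2 ^ N" for x
        using that w(1) by (metis carrier_vecD index_smult_vec(1) index_vec)
      have "m * ip (2 ^ N) (($) w) (state (nth l) 0) = ip (2 ^ N) (quad N H (($) w)) (state (nth l) 0)"
        unfolding ip_scale_left[symmetric] by (rule ip_cong) (simp_all add: quad_w)
      also have "\<dots> = ip (2 ^ N) (($) w) (quad N H (state (nth l) 0))"
        by (rule quad_adjoint) (rule herm)
      also have "quad N H (state (nth l) 0) = (\<lambda>x. of_real (\<epsilon> (nth l)) * state (nth l) 0 x)"
        by (rule ext) (rule quad_H)
      finally have "m = of_real (\<epsilon> (nth l))" using nz by (simp add: ip_scale_right)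
      moreover have "\<epsilon> (nth g) \<le> \<epsilon> (nth l)"
      proof -
        have "\<epsilon> (nth g) = (\<Sum>k<N. if k < 2 * b \<and> odd k then energy s k else 0)"
          unfolding \<epsilon>_def by (intro sum.cong) (auto simp: g(2))
        then show ?thesis using sum_energy_ground_le[of s "nth l"] s unfolding \<epsilon>_def by simp
      qed
      ultimately show ?thesis by simp
    qed
    ultimately show ?thesis using g(1) HE[of g]
      by (intro exI[of _ g] conjI exI[of _ "complex_of_real (\<epsilon> (nth g))"]) auto
  qed
  ultimately show ?thesis using HE NE
    by (intro exI[of _ E] exI[of _ n] conjI) blast+
qed

end
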